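(* Let $\psi:\mathbb{N}\to\mathbb{R}_{>0}$ be monotone decreasing and suppose there exist $\varepsilon>0$ and an integer $k\ge2$ such that $$\sum_{q}\frac{\psi(q)}{\sqrt{\log q}\,(\log\log q)(\log\log\log q)\cdots(\log^{(k)}q)^{1+\varepsilon}}=\infty .$$ Let $(\gamma_q)_{q\in\mathbb{N}}$ be any sequence of real numbers. For each $q\in\mathbb{N}$ let $(\epsilon_{a,q})_{a\in\mathbb{Z}}$ be a family of real numbers which is $q$-periodic in $a$ (i.e. $\epsilon_{a+q,q}=\epsilon_{a,q}$ for all $a$) and satisfies $|\epsilon_{a,q}|\le C_0\psi(q)$, for some constant $C_0>0$ independent of $a$ and $q$. Set $\gamma_{a,q}=\gamma_q+\epsilon_{a,q}$. Then for every $y\in\mathbb{N}$ and every $z\in\{0,1,\dots,y-1\}$, the set $$W_{y,z}(\psi,\gamma)=\Bigl\{\beta\in\mathbb{T}:\ \text{for infinitely many } q\in\mathbb{N} \text{ with } q\equiv z \ (\mathrm{mod}\ y) \text{ there is } a\in\mathbb{Z} \text{ with } \Bigl\|\beta-\frac{a+\gamma_{a,q}}{q}\Bigr\|<\frac{\psi(q)}{q}\Bigr\}$$ has full Lebesgue measure, i.e. $\mathrm{m}(W_{y,z}(\psi,\gamma))=1$.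
   Context: $\mathbb{N}$ denotes the positive integers, $\mathbb{T}=\mathbb{R}/\mathbb{Z}$, $\mathrm{m}$ is Lebesgue (probability) measure on $\mathbb{T}$, and $\|x\|$ is the distance from $x$ to the nearest integer. $\log^{(i)}$ denotes the $i$-fold iterated logarithm (so $\log^{(2)}q=\log\log q$); the denominator in the series is $\sqrt{\log q}\,\prod_{i=2}^{k-1}\log^{(i)}q\cdot(\log^{(k)}q)^{1+\varepsilon}$, and the sum is over $q$ large enough that all the iterated logarithms are defined and positive. *)

theory Defs
  imports "HOL-Analysis.Analysis" "HOL-Number_Theory.Cong"
begin

text \<open>The circle \<open>\<real>/\<int>\<close> is modelled by its fundamental domain \<open>[0,1)\<close>, carrying
  Lebesgue measure. Positive integers are elements of \<open>nat\<close> restricted to \<open>{1..}\<close>.\<close>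

definition torus :: "real set" where
  "torus = {0..<1}"

definition torus_measure :: "real measure" where
  "torus_measure = restrict_space lebesgue torus"

definition dist_nearest_int :: "real \<Rightarrow> real" where
  "dist_nearest_int x = infdist x \<int>"

definition iter_log :: "nat \<Rightarrow> real \<Rightarrow> real" where
  "iter_log i = ln ^^ i"

text \<open>The exponent \<open>1 + \<epsilon>\<close> belongs to the \<open>k\<close>-th iterated logarithm only; for \<open>k = 2\<close> the
  product over intermediate logarithms is empty.\<close>

definition log_weight :: "nat \<Rightarrow> real \<Rightarrow> nat \<Rightarrow> real" where
  "log_weight k \<epsilon> q =
     sqrt (ln (real q)) * (\<Prod>i\<in>{2..<k}. iter_log i (real q)) *
     iter_log k (real q) powr (1 + \<epsilon>)"

text \<open>Requiring every iterated logarithm up to order \<open>k\<close> to be positive also guarantees that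
  \<open>ln\<close> is never applied to a nonpositive argument.\<close>

definition log_domain :: "nat \<Rightarrow> nat set" where
  "log_domain k = {q. 1 \<le> q \<and> (\<forall>i\<in>{1..k}. 0 < iter_log i (real q))}"

text \<open>For positive \<open>\<psi>\<close> all terms are positive, so non-summability says that the sum is infinite.\<close>

definition weighted_series_diverges :: "(nat \<Rightarrow> real) \<Rightarrow> nat \<Rightarrow> real \<Rightarrow> bool" where
  "weighted_series_diverges \<psi> k \<epsilon> \<longleftrightarrow>
     \<not> (\<lambda>q. \<psi> q / log_weight k \<epsilon> q) summable_on log_domain k"

definition W_set :: "nat \<Rightarrow> nat \<Rightarrow> (nat \<Rightarrow> real) \<Rightarrow> (int \<Rightarrow> nat \<Rightarrow> real) \<Rightarrow> real set" where
  "W_set y z \<psi> \<gamma> =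
     {\<beta> \<in> torus. infinite {q. 1 \<le> q \<and> [q = z] (mod y) \<and>
        (\<exists>a::int. dist_nearest_int (\<beta> - (of_int a + \<gamma> a q) / real q) < \<psi> q / real q)}}"

end

theory Submission
  imports Defs "HOL-Number_Theory.Prime_Powers" "HOL-Real_Asymp.Real_Asymp"
begin

text \<open>
  Write \<open>S(R) = \<psi>(1) + \<dots> + \<psi>(R)\<close>. The limsup set has full measure because a suitable sparse
  family of denominators is quasi-independent, although the targets \<open>\<gamma>\<^sub>q\<close> move arbitrarily.

  \<^bold>\<open>Overlaps.\<close> Let \<open>A\<^sub>q\<close> be a union of disjoint arcs of radius \<open>\<psi>(q)/q\<close> around points
  \<open>(a + \<gamma>\<^sub>a\<^sub>q)/q\<close>. For \<open>q \<le> r\<close> the number of intersecting pairs of arcs is governed by the linear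
  form \<open>a r - b q\<close>, which gives
  \<open>m(A\<^sub>q \<inter> A\<^sub>r) \<lesssim> \<psi>(q) \<psi>(r) + \<psi>(r) gcd(q,r)/r\<close> (\<open>measure_arcs_Int_le\<close>). The second
  term accounts for a single multiple of the gcd falling close to the shift caused by the targets; as the
  targets are arbitrary this can happen for every pair, so the gcd has to be controlled by the choice of the
  denominators.

  \<^bold>\<open>Denominators.\<close> Take only \<open>q\<close> in the residue class whose prime factors up to \<open>z\<close> all divide
  \<open>y\<close>, where \<open>ln z\<close> is a small multiple of \<open>sqrt (ln R)\<close>. These numbers have density about
  \<open>1 / ln z\<close> (\<open>card_rough_upper\<close>, \<open>rough_class_lower\<close>), so \<open>\<Psi> = \<Sum>\<psi>(q)\<close> over them is
  about \<open>S(R) / ln z\<close>, while the gcd sum is only \<open>S(R) / ln z\<close> as well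
  (\<open>sum_rough_gcd_upper\<close>). Hence the gcd sum is \<open>O(\<Psi>\<^sup>2)\<close> as soon as \<open>\<Psi>\<close> is bounded below, that
  is, as soon as \<open>S(R) \<ge> sqrt (ln R)\<close>: this is where the square root in the hypothesis is used. The
  divergence hypothesis makes \<open>S(R) / sqrt (ln R)\<close> unbounded
  (\<open>weighted_series_diverges_imp_unbounded\<close>). At an \<open>R\<close> where this ratio exceeds all its
  previous values, at most half of \<open>S(R)\<close> comes from \<open>q \<le> R\<^bsup>1/4\<^esup>\<close>, so only \<open>q\<close> that are large
  compared with \<open>z\<close> matter, and for these the sieve works.

  \<^bold>\<open>Full measure.\<close> With \<open>f = \<Sum>1\<^bsub>A\<^sub>q\<^esub>\<close> over the chosen \<open>q\<close> we have \<open>\<integral>f\<^sup>2 \<lesssim> \<Psi>\<^sup>2\<close> on the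
  whole circle, and \<open>\<integral>\<^sub>I f \<greatersim> \<Psi> |I|\<close> for every cell \<open>I\<close> of a fixed grid once all \<open>q\<close>
  are large. If a set \<open>B\<close> of positive measure missed all \<open>A\<^sub>q\<close> with \<open>q\<close> large, approximate \<open>B\<close> by a finite union \<open>U\<close>
  of cells: then \<open>\<integral>\<^sub>U f\<close> is at least a constant times \<open>\<Psi> |B|\<close>, but \<open>f\<close> vanishes on \<open>B\<close>,
  and Cauchy-Schwarz on the tiny set \<open>U - B\<close> makes the integral smaller than that
  (\<open>negligible_missed_points\<close>). Only the global second moment enters. This matters because overlaps of moving
  targets need not be equidistributed, so a second moment bound on each short interval is not available.
\<close>

section \<open>Summation by parts\<close>

text \<open>Abel summation: the weighted sum is a nonnegative combination of the partial sums of \<open>c\<close>.\<close>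
lemma sum_weighted_nonneg:
  fixes c w :: "nat \<Rightarrow> real"
  assumes "\<And>n. n \<le> N \<Longrightarrow> 0 \<le> (\<Sum>i=m..n. c i)"
    and "\<And>i. m \<le> i \<Longrightarrow> i \<le> N \<Longrightarrow> 0 \<le> w i"
    and "\<And>i. m \<le> i \<Longrightarrow> Suc i \<le> N \<Longrightarrow> w (Suc i) \<le> w i"
  shows "0 \<le> (\<Sum>i=m..N. c i * w i)"
proof (cases "m \<le> N")
  case True
  have "w n * (\<Sum>i=m..n. c i) \<le> (\<Sum>i=m..n. c i * w i)" if "m \<le> n" "n \<le> N" for n
    using that
  proof (induction n rule: dec_induct)
    case base then show ?case by simp
  next
    case (step n)
    have "w (Suc n) * (\<Sum>i=m..n. c i) \<le> w n * (\<Sum>i=m..n. c i)"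
      using step assms(1)[of n] assms(3)[of n] by (intro mult_right_mono) auto
    with step show ?case by (simp add: algebra_simps)
  qed
  from this[of N] True assms(1)[of N] assms(2)[of N] show ?thesis
    by (smt (verit) mult_nonneg_nonneg order_refl)
qed auto

text \<open>The form in which density statements about sets of integers are transferred to sums of a
  decreasing function over these sets.\<close>
lemma sum_weighted_mono:
  fixes a b w :: "nat \<Rightarrow> real"
  assumes "\<And>n. n \<le> N \<Longrightarrow> (\<Sum>i=m..n. a i) \<le> (\<Sum>i=m..n. b i)"
    and "\<And>i. m \<le> i \<Longrightarrow> i \<le> N \<Longrightarrow> 0 \<le> w i"
    and "\<And>i. m \<le> i \<Longrightarrow> Suc i \<le> N \<Longrightarrow> w (Suc i) \<le> w i"
  shows "(\<Sum>i=m..N. a i * w i) \<le> (\<Sum>i=m..N. b i * w i)"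
proof -
  have "0 \<le> (\<Sum>i=m..N. (b i - a i) * w i)"
    by (rule sum_weighted_nonneg) (use assms in \<open>auto simp: sum_subtractf\<close>)
  then show ?thesis by (simp add: algebra_simps sum_subtractf)
qed

section \<open>Chebyshev and Mertens estimates\<close>

lemma sum_mangoldt_mult_div:
  "(\<Sum>d=1..n. (mangoldt d :: real) * real (n div d)) = ln (fact n)"
proof (induction n)
  case 0 then show ?case by simp
next
  case (Suc n)
  have "(\<Sum>d=1..Suc n. (mangoldt d :: real) * real (Suc n div d))
      = (\<Sum>d=1..Suc n. mangoldt d * real (n div d) + (if d dvd Suc n then mangoldt d else 0))"
    by (intro sum.cong) (auto simp: div_Suc dvd_eq_mod_eq_0 algebra_simps)
  also have "\<dots> = (\<Sum>d=1..Suc n. mangoldt d * real (n div d)) 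
      + (\<Sum>d\<in>{d\<in>{1..Suc n}. d dvd Suc n}. mangoldt d)"
    by (simp only: sum.distrib sum.inter_filter finite_atLeastAtMost)
  also have "{d\<in>{1..Suc n}. d dvd Suc n} = {d. d dvd Suc n}"
    by (auto dest: dvd_imp_le simp: Suc_le_eq intro!: Nat.gr0I)
  also have "(\<Sum>d\<in>{d. d dvd Suc n}. mangoldt d :: real) = ln (Suc n)"
    by (subst mangoldt_sum) auto
  also have "(\<Sum>d=1..Suc n. mangoldt d * real (n div d)) = (ln (fact n) :: real)"
    using Suc by (simp add: div_less)
  finally show ?case
    by (simp add: ln_mult add.commute del: of_nat_Suc)
qed

text \<open>Chebyshev's argument: every \<open>d\<close> in \<open>(k, 2k]\<close> contributes fully to the logarithm of the central
  binomial coefficient, which is at most \<open>2k ln 2\<close>.\<close>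
lemma sum_mangoldt_double:
  "(\<Sum>d=1..2*k. mangoldt d) \<le> (\<Sum>d=1..k. mangoldt d) + 2 * real k * ln 2"
proof -
  have 1: "(\<Sum>d=1..k. (mangoldt d :: real) * real (k div d))
         = (\<Sum>d=1..2*k. (mangoldt d :: real) * real (k div d))"
    by (intro sum.mono_neutral_left) auto
  have "(\<Sum>d\<in>{k<..2*k}. (mangoldt d :: real))
      = (\<Sum>d=1..2*k. if k < d then mangoldt d else 0)"
    by (subst sum.inter_filter [symmetric]) (auto intro!: sum.cong)
  also have "\<dots> \<le> (\<Sum>d=1..2*k. (mangoldt d :: real) * (real (2*k div d) - 2 * real (k div d)))"
  proof (intro sum_mono)
    fix d assume d: "d \<in> {1..2*k}"
    have "2 * (k div d) \<le> 2 * k div d"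
      using d div_times_less_eq_dividend[of k d] by (simp add: less_eq_div_iff_mult_less_eq)
    moreover have "2*k div d = 1" "k div d = 0" if "k < d"
      using d that by (auto intro: div_nat_eqI)
    ultimately show "(if k < d then mangoldt d else 0)
         \<le> (mangoldt d :: real) * (real (2*k div d) - 2 * real (k div d))"
      using mangoldt_nonneg[of d] by (auto intro!: mult_nonneg_nonneg)
  qed
  also have "\<dots> = ln (fact (2*k)) - 2 * ln (fact k)"
    unfolding sum_mangoldt_mult_div[symmetric] 1
    by (simp add: algebra_simps sum_subtractf sum_distrib_left)
  also have "\<dots> = ln (real (2*k choose k))"
    by (simp add: binomial_fact ln_div ln_mult)
  also have "\<dots> \<le> ln (2 ^ (2*k))"
  proof -
    have "2*k choose k \<le> 2 ^ (2*k)" by (rule binomial_le_pow2)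
    then have "real (2*k choose k) \<le> 2 ^ (2*k)" by (metis of_nat_le_iff of_nat_numeral of_nat_power)
    then show ?thesis by (intro ln_mono) (auto simp: zero_less_binomial_iff)
  qed
  also have "\<dots> = 2 * real k * ln 2" by (simp add: ln_realpow)
  finally have "(\<Sum>d\<in>{k<..2*k}. mangoldt d) \<le> 2 * real k * ln 2" .
  moreover have "(\<Sum>d=1..2*k. mangoldt d :: real) = (\<Sum>d=1..k. mangoldt d) + (\<Sum>d\<in>{k<..2*k}. mangoldt d)"
    by (subst sum.union_disjoint [symmetric]) (auto intro!: sum.cong)
  ultimately show ?thesis by simp
qed

lemma chebyshev_upper: "(\<Sum>d=1..n. mangoldt d) \<le> 6 * real n"
proof (induction n rule: less_induct)
  case (less n)
  show ?case
  proof (cases "n \<le> 1")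
    case True
    then have "n = 0 \<or> n = 1" by auto
    then show ?thesis by auto
  next
    case False
    define k where "k = (n + 1) div 2"
    have k: "n \<le> 2*k" "2*k \<le> n + 1" "k < n" using False by (auto simp: k_def)
    have "(\<Sum>d=1..n. mangoldt d :: real) \<le> (\<Sum>d=1..2*k. mangoldt d)"
      using k by (intro sum_mono2) (auto simp: mangoldt_nonneg)
    also have "\<dots> \<le> (\<Sum>d=1..k. mangoldt d) + 2 * real k * ln 2"
      by (rule sum_mangoldt_double)
    also have "\<dots> \<le> 6 * real k + 2 * real k * 1"
      using less[OF k(3)] ln_2_less_1 by (intro add_mono mult_left_mono) auto
    also have "\<dots> \<le> 6 * real n" using k(2) False by simp
    finally show ?thesis .
  qed
qed

text \<open>Compare \<open>ln (n!) = \<Sum>\<Lambda>(d) \<lfloor>n/d\<rfloor>\<close> with \<open>n ln n\<close>; replacing the floor by \<open>n/d - 1\<close> costs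
  the Chebyshev sum.\<close>
lemma mertens_first_upper:
  assumes "n \<ge> 1"
  shows "(\<Sum>d=1..n. mangoldt d / real d) \<le> ln (real n) + 6"
proof -
  have "(\<Sum>d=1..n. mangoldt d * (real n / real d - 1)) \<le> (\<Sum>d=1..n. mangoldt d * real (n div d))"
  proof (intro sum_mono mult_left_mono mangoldt_nonneg)
    fix d assume "d \<in> {1..n}"
    then show "real n / real d - 1 \<le> real (n div d)"
      by (smt (verit) floor_divide_of_nat_eq of_int_of_nat_eq real_of_int_floor_add_one_gt)
  qed
  also have "\<dots> \<le> real n * ln (real n)"
  proof -
    have "fact n \<le> (real n) ^ n" by (metis fact_le_power of_nat_fact order_refl of_nat_power of_nat_le_iff)
    then have "ln (fact n) \<le> ln (real n ^ n)" by (intro ln_mono) auto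
    then show ?thesis using assms by (simp add: sum_mangoldt_mult_div[simplified] ln_realpow)
  qed
  finally have "real n * (\<Sum>d=1..n. mangoldt d / real d) - (\<Sum>d=1..n. mangoldt d) \<le> real n * ln (real n)"
    by (simp add: algebra_simps sum_subtractf sum_distrib_left)
  with chebyshev_upper[of n] have "real n * (\<Sum>d=1..n. mangoldt d / real d) \<le> real n * (ln (real n) + 6)"
    by (simp add: algebra_simps)
  then show ?thesis using assms by (simp add: mult_le_cancel_left)
qed

text \<open>Partial summation from \<open>ln p / p\<close> to \<open>1 / p\<close>. The constant \<open>1\<close> in front of \<open>ln (ln n)\<close> is
  essential: it is the exponent of \<open>ln n\<close> in the product estimate derived next.\<close>
lemma sum_prime_reciprocals_upper:
  "\<exists>C. \<forall>n\<ge>2. (\<Sum>p | prime p \<and> p \<le> n. 1 / real p) \<le> ln (ln (real n)) + C"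
proof (intro exI allI impI)
  fix n :: nat assume n: "n \<ge> 2"
  define a where "a i = (if prime i then ln (real i) / real i else 0)" for i :: nat
  \<comment> \<open>\<open>b\<close> is chosen so that its partial sums telescope to Mertens' bound \<open>ln m + 6\<close>\<close>
  define b where "b i = (if i = 2 then ln 2 + 6 else ln (real i) - ln (real (i-1)))" for i :: nat
  have b: "(\<Sum>i=2..m. b i) = ln (real m) + 6" if "m \<ge> 2" for m
    using that by (induction m rule: dec_induct) (auto simp: b_def)
  have ab: "(\<Sum>i=2..m. a i) \<le> (\<Sum>i=2..m. b i)" for m
  proof (cases "m \<ge> 2")
    case True
    have "(\<Sum>i=2..m. a i) \<le> (\<Sum>i=1..m. mangoldt i / real i)"
      by (rule order_trans[OF sum_mono2[of "{1..m}"] sum_mono])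
         (auto simp: a_def mangoldt_nonneg)
    with True b[of m] mertens_first_upper[of m] show ?thesis by simp
  qed auto
  have "(\<Sum>p | prime p \<and> p \<le> n. 1 / real p) = (\<Sum>i=2..n. if prime i then 1 / real i else 0)"
    by (subst sum.inter_filter [symmetric]) (auto intro!: sum.cong dest: prime_ge_2_nat)
  also have "\<dots> = (\<Sum>i=2..n. a i * (1 / ln (real i)))"
    by (intro sum.cong) (auto simp: a_def)
  also have "\<dots> \<le> (\<Sum>i=2..n. b i * (1 / ln (real i)))"
    by (rule sum_weighted_mono[OF ab]) (auto intro!: divide_left_mono)
  also have "\<dots> \<le> ln (ln (real n)) + ((ln 2 + 6) / ln 2 - ln (ln 2))"
    using n
  proof (induction n rule: dec_induct)
    case base then show ?case by (simp add: b_def)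
  next
    case (step m)
    define u v where "u = ln (real (Suc m))" and "v = ln (real m)"
    have uv: "u > 0" "v > 0" using step by (auto simp: u_def v_def)
    have "ln (v / u) \<le> v / u - 1" using uv by (intro ln_le_minus_one) auto
    then have "(u - v) / u \<le> ln u - ln v" using uv by (simp add: ln_div diff_divide_distrib)
    moreover have "b (Suc m) * (1 / ln (real (Suc m))) = (u - v) / u"
      using step by (simp add: b_def u_def v_def)
    ultimately show ?case using step by (simp add: u_def v_def del: of_nat_Suc)
  qed
  finally show "(\<Sum>p | prime p \<and> p \<le> n. 1 / real p) \<le> ln (ln (real n)) + ((ln 2 + 6) / ln 2 - ln (ln 2))" .
qed

lemma mertens_product_lower:
  "\<exists>c>0. \<forall>n\<ge>2. c / ln (real n) \<le> (\<Prod>p | prime p \<and> p \<le> n. 1 - 1 / real p)"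
proof -
  obtain C where C: "\<And>n. n \<ge> 2 \<Longrightarrow> (\<Sum>p | prime p \<and> p \<le> n. 1 / real p) \<le> ln (ln (real n)) + C"
    using sum_prime_reciprocals_upper by blast
  have "exp (-C - 4) / ln (real n) \<le> (\<Prod>p | prime p \<and> p \<le> n. 1 - 1 / real p)" if n: "n \<ge> 2" for n
  proof -
    let ?P = "{p. prime p \<and> p \<le> n}"
    have fin: "finite ?P" by simp
    have sq: "(\<Sum>p\<in>?P. 1 / real p ^ 2) \<le> 2"
    proof -
      have "(\<Sum>p\<in>?P. 1 / real p ^ 2) \<le> (\<Sum>i=1..n. 1 / real i ^ 2)"
        by (intro sum_mono2) (auto dest: prime_gt_0_nat simp: Suc_le_eq)
      also have "\<dots> \<le> 2 - 1 / real n"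
        using that
      proof (induction n rule: dec_induct)
        case base then show ?case by (simp add: numeral_2_eq_2)
      next
        case (step m)
        have "1 / real (Suc m) ^ 2 \<le> 1 / real m - 1 / real (Suc m)"
        proof -
          have "1 / real m - 1 / real (Suc m) = 1 / (real m * real (Suc m))"
            using step by (simp add: field_simps)
          moreover have "1 / real (Suc m) ^ 2 \<le> 1 / (real m * real (Suc m))"
            using step by (intro divide_left_mono) (auto simp: power2_eq_square intro!: mult_right_mono)
          ultimately show ?thesis by simp
        qed
        with step show ?case by simp
      qed
      also have "\<dots> \<le> 2" by simp
      finally show ?thesis .
    qed
    have "exp (-C - 4) / ln (real n) = exp (- (ln (ln (real n)) + C) - 2 * 2)"
      using n by (simp add: exp_diff exp_minus exp_add field_simps)
    also have "\<dots> \<le> exp (- (\<Sum>p\<in>?P. 1 / real p) - 2 * (\<Sum>p\<in>?P. 1 / real p ^ 2))"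
      using C[OF n] sq by simp
    also have "\<dots> = (\<Prod>p\<in>?P. exp (- (1 / real p) - 2 * (1 / real p)^2))"
      by (simp add: exp_sum[OF fin, symmetric] sum_subtractf sum_negf sum_distrib_left power_divide)
    also have "\<dots> \<le> (\<Prod>p\<in>?P. 1 - 1 / real p)"
    proof (intro prod_mono conjI)
      fix p assume "p \<in> ?P"
      then have p: "real p \<ge> 2" using prime_ge_2_nat by auto
      then have "- (1 / real p) - 2 * (1 / real p)^2 \<le> ln (1 - 1 / real p)"
        by (intro ln_one_minus_pos_lower_bound) (auto simp: field_simps)
      then have "exp (- (1 / real p) - 2 * (1 / real p)^2) \<le> exp (ln (1 - 1 / real p))" by simp
      also have "\<dots> = 1 - 1 / real p" using p by (subst exp_ln) auto
      finally show "exp (- (1 / real p) - 2 * (1 / real p)^2) \<le> 1 - 1 / real p" .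
    qed auto
    finally show ?thesis .
  qed
  then show ?thesis by (intro exI[of _ "exp (-C-4)"]) auto
qed

section \<open>Upper bounds for rough numbers\<close>

text \<open>Rough numbers relative to \<open>y\<close>. Prime factors of \<open>y\<close> are exempted because in a residue class
  \<open>z\<^sub>0\<close> modulo \<open>y\<close> divisibility by such a prime is decided by \<open>z\<^sub>0\<close> alone.\<close>
definition rough :: "nat \<Rightarrow> nat \<Rightarrow> nat set" where
  "rough y z = {n. 0 < n \<and> (\<forall>p. prime p \<longrightarrow> p dvd n \<longrightarrow> p \<le> z \<longrightarrow> p dvd y)}"

lemma rough_pos: "n \<in> rough y z \<Longrightarrow> 0 < n"
  by (simp add: rough_def)

lemma rough_dvd: "n \<in> rough y z \<Longrightarrow> d dvd n \<Longrightarrow> d \<in> rough y z"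
  by (auto simp: rough_def dest: dvd_trans intro!: Nat.gr0I)

lemma sum_reciprocals_upper:
  assumes "n \<ge> 1"
  shows "(\<Sum>i=1..n. 1 / real i) \<le> 1 + ln (real n)"
  using assms
proof (induction n rule: dec_induct)
  case base then show ?case by simp
next
  case (step m)
  have "ln (real m / real (Suc m)) \<le> real m / real (Suc m) - 1"
    using step by (intro ln_le_minus_one) auto
  also have "\<dots> = - 1 / real (Suc m)" by (simp add: field_simps)
  finally have "1 / real (Suc m) \<le> ln (real (Suc m)) - ln (real m)"
    using step by (simp add: ln_div)
  with step show ?case by simp
qed

text \<open>The numbers \<open>1, y + 1, 2y + 1, \<dots>\<close> suffice. The condition on \<open>z\<close> gives
  \<open>ln (z/y) \<ge> ln z / 2\<close>.\<close>
lemma sum_coprime_reciprocals_lower: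
  assumes "y \<ge> 1" "z \<ge> y ^ 2"
  shows "ln (real z) / (2 * real y) \<le> (\<Sum>s\<in>{s\<in>{1..z}. coprime s y}. 1 / real s)"
proof -
  have z: "z \<ge> 1" using assms by (metis one_le_power order_trans)
  define J where "J = (z - 1) div y"
  have "ln (real y ^ 2) \<le> ln (real z)" 
    using assms z by (intro ln_mono) (auto simp flip: of_nat_power)
  then have "ln (real z) / 2 \<le> ln (real z) - ln (real y)" using assms by (simp add: ln_realpow)
  also have "\<dots> = ln (real z / real y)" using assms z by (simp add: ln_div)
  also have "\<dots> \<le> ln (real J + 1 + 1)"
  proof (intro ln_mono)
    have "z - 1 < (J + 1) * y" unfolding J_def using assms
      by (metis add.commute div_less_iff_less_mult lessI less_le_trans not_gr_zero not_one_le_zero plus_1_eq_Suc)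
    then have "z \<le> (J + 1) * y" using z by linarith
    then have "real z \<le> real ((J + 1) * y)" by (rule of_nat_mono)
    then have "real z \<le> (real J + 1) * real y" by (simp add: algebra_simps)
    then have "real z / real y \<le> real J + 1" using assms by (simp add: pos_divide_le_eq)
    then show "real z / real y \<le> real J + 1 + 1" by simp
  qed (use assms z in auto)
  also have "\<dots> \<le> harm (J + 1)" using harm_ge_ln[of "J+1"] by (simp add: add_ac)
  finally have 1: "ln (real z) / 2 \<le> harm (J + 1)" .
  have "harm (J + 1) / real y = (\<Sum>j\<le>J. 1 / (real y * real (j + 1)))"
    by (simp add: harm_altdef sum_divide_distrib lessThan_Suc_atMost field_simps)
  also have "\<dots> \<le> (\<Sum>j\<le>J. 1 / real (y * j + 1))"
    using assms by (intro sum_mono frac_le) (auto simp: algebra_simps intro!: add_pos_nonneg)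
  also have "\<dots> = (\<Sum>s\<in>(\<lambda>j. y * j + 1) ` {..J}. 1 / real s)"
    using assms by (subst sum.reindex) (auto simp: inj_on_def)
  also have "\<dots> \<le> (\<Sum>s\<in>{s\<in>{1..z}. coprime s y}. 1 / real s)"
  proof (intro sum_mono2)
    show "(\<lambda>j. y * j + 1) ` {..J} \<subseteq> {s \<in> {1..z}. coprime s y}"
    proof (rule image_subsetI)
      fix j assume "j \<in> {..J}"
      then have "j \<le> J" by simp
      then have "y * j \<le> y * J" by simp
      also have "\<dots> \<le> z - 1" by (simp add: J_def)
      finally have "y * j < z" using z by linarith
      moreover have "coprime (y * j + 1) y"
        by (metis coprime_1_left coprime_iff_gcd_eq_1 gcd.commute gcd_add_mult mult.commute)
      ultimately show "y * j + 1 \<in> {s \<in> {1..z}. coprime s y}" by simp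
    qed
  qed auto
  finally have "harm (J + 1) / real y \<le> (\<Sum>s\<in>{s\<in>{1..z}. coprime s y}. 1 / real s)" .
  moreover have "ln (real z) / (2 * real y) \<le> harm (J + 1) / real y"
    using divide_right_mono[OF 1, of "real y"] by simp
  ultimately show ?thesis by linarith
qed

text \<open>A rough \<open>m\<close> and an \<open>s \<le> z\<close> coprime to \<open>y\<close> have no common prime factor, so the product \<open>m s\<close>
  determines both.\<close>
lemma sum_rough_reciprocals_mult:
  "(\<Sum>m\<in>rough y z \<inter> {..x}. 1 / real m) * (\<Sum>s\<in>{s\<in>{1..z}. coprime s y}. 1 / real s)
     \<le> (\<Sum>n=1..x*z. 1 / real n)"
proof -
  let ?A = "rough y z \<inter> {..x}" and ?B = "{s\<in>{1..z}. coprime s y}"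
  have cop: "coprime m s" if "m \<in> ?A" "s \<in> ?B" for m s
  proof (rule ccontr)
    assume "\<not> coprime m s"
    then obtain p where p: "prime p" "p dvd m" "p dvd s"
      by (metis coprime_iff_gcd_eq_1 gcd_nat.bounded_iff prime_factor_nat)
    then have "p \<le> z" using that by (auto dest: dvd_imp_le)
    then have "p dvd y" using p that by (auto simp: rough_def)
    then show False using p that by (auto simp: coprime_def dest: not_prime_unit)
  qed
  have inj: "inj_on (\<lambda>(m, s). m * s) (?A \<times> ?B)"
  proof (rule inj_onI, clarify)
    fix m s m' s'
    assume *: "m \<in> rough y z" "m \<le> x" "m' \<in> rough y z" "m' \<le> x" "s \<in> {1..z}" "coprime s y"
      "s' \<in> {1..z}" "coprime s' y" and eq: "m * s = m' * s'"
    have "m dvd m'" using cop[of m s'] * eq by (metis IntI atMost_iff coprime_dvd_mult_left_iff dvd_triv_left mem_Collect_eq)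
    moreover have "m' dvd m" using cop[of m' s] * eq by (metis IntI atMost_iff coprime_dvd_mult_left_iff dvd_triv_left mem_Collect_eq)
    ultimately have "m = m'" by (rule dvd_antisym)
    with eq rough_pos[OF *(1)] show "m = m' \<and> s = s'" by simp
  qed
  have "(\<Sum>m\<in>?A. 1 / real m) * (\<Sum>s\<in>?B. 1 / real s) = (\<Sum>(m,s)\<in>?A \<times> ?B. 1 / real (m * s))"
    by (simp add: sum_product sum.cartesian_product)
  also have "\<dots> = (\<Sum>n\<in>(\<lambda>(m, s). m * s) ` (?A \<times> ?B). 1 / real n)"
    by (subst sum.reindex[OF inj]) (auto intro!: sum.cong)
  also have "\<dots> \<le> (\<Sum>n=1..x*z. 1 / real n)"
    by (intro sum_mono2) (auto intro: mult_le_mono simp: Suc_le_eq rough_pos)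
  finally show ?thesis .
qed

text \<open>Dividing the harmonic sum up to \<open>x z\<close> by the harmonic sum over the \<open>s\<close> saves a factor \<open>ln z\<close>.
  This elementary bound replaces an upper bound sieve.\<close>
lemma sum_rough_reciprocals_upper:
  assumes "y \<ge> 1" "z \<ge> y ^ 2" "z \<ge> 3" "x \<ge> z"
  shows "(\<Sum>m\<in>rough y z \<inter> {..x}. 1 / real m) \<le> 6 * real y * ln (real x) / ln (real z)"
proof -
  let ?S = "\<Sum>m\<in>rough y z \<inter> {..x}. 1 / real m"
  have "exp 1 \<le> real x" using assms exp_le by linarith
  then have lx: "1 \<le> ln (real x)" using assms by (subst ln_ge_iff) auto
  have lz: "0 < ln (real z)" "ln (real z) \<le> ln (real x)" using assms by auto
  have "?S * (ln (real z) / (2 * real y)) \<le> ?S * (\<Sum>s\<in>{s\<in>{1..z}. coprime s y}. 1 / real s)"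
    using assms by (intro mult_left_mono sum_coprime_reciprocals_lower sum_nonneg) auto
  also have "\<dots> \<le> (\<Sum>n=1..x*z. 1 / real n)" by (rule sum_rough_reciprocals_mult)
  also have "\<dots> \<le> 1 + ln (real (x * z))" using assms by (intro sum_reciprocals_upper) auto
  also have "\<dots> \<le> 3 * ln (real x)"
  proof -
    have "ln (real (x * z)) = ln (real x) + ln (real z)" using assms by (simp add: ln_mult)
    with lx lz show ?thesis by linarith
  qed
  finally show ?thesis using lz assms by (simp add: field_simps)
qed

text \<open>Write \<open>ln n\<close> as the sum of \<open>\<Lambda>(d)\<close> over \<open>d | n\<close> and put \<open>n = m d\<close>. The cofactor \<open>m\<close> is again
  rough, and Chebyshev bounds the sum over \<open>d \<le> x/m\<close>.\<close>
lemma sum_rough_ln_upper: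
  "(\<Sum>n\<in>rough y z \<inter> {..x}. ln (real n)) \<le> 6 * real x * (\<Sum>m\<in>rough y z \<inter> {..x}. 1 / real m)"
proof -
  let ?V = "rough y z \<inter> {..x}"
  have pos: "n > 0" if "n \<in> ?V" for n using that rough_pos by blast
  have "(\<Sum>n\<in>?V. ln (real n)) = (\<Sum>n\<in>?V. \<Sum>d | d dvd n. mangoldt d)"
    using pos by (intro sum.cong refl) (simp add: mangoldt_sum)
  also have "\<dots> = (\<Sum>n\<in>?V. \<Sum>m | m dvd n. mangoldt (n div m))"
  proof (rule sum.cong[OF refl])
    fix n assume n: "n \<in> ?V"
    show "(\<Sum>d | d dvd n. mangoldt d :: real) = (\<Sum>m | m dvd n. mangoldt (n div m))"
      by (rule sum.reindex_bij_witness[of _ "\<lambda>m. n div m" "\<lambda>d. n div d"])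
         (use pos[OF n] in auto)
  qed
  also have "\<dots> = (\<Sum>(n,m)\<in>(SIGMA n:?V. {m. m dvd n}). mangoldt (n div m))"
    using pos by (subst sum.Sigma) auto
  also have "\<dots> = (\<Sum>(m,d)\<in>(\<lambda>(n,m). (m, n div m)) ` (SIGMA n:?V. {m. m dvd n}). mangoldt d)"
  proof (subst sum.reindex)
    show "inj_on (\<lambda>(n, m). (m, n div m)) (SIGMA n:?V. {m. m dvd n})"
      by (auto simp: inj_on_def elim!: dvdE)
  qed (auto intro!: sum.cong)
  also have "\<dots> \<le> (\<Sum>(m,d)\<in>(SIGMA m:?V. {1..x div m}). mangoldt d)"
  proof (intro sum_mono2)
    show "(\<lambda>(n, m). (m, n div m)) ` (SIGMA n:?V. {m. m dvd n}) \<subseteq> (SIGMA m:?V. {1..x div m})"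
    proof clarify
      fix n m assume n: "n \<in> rough y z" "n \<le> x" "m dvd n"
      have "m \<le> x" using n rough_pos[OF n(1)] by (meson dvd_imp_le order_trans)
      moreover have "0 < n div m" using n rough_pos[OF n(1)] by (auto elim!: dvdE)
      ultimately show "m \<in> rough y z \<inter> {..x} \<and> n div m \<in> {1..x div m}"
        using rough_dvd[OF n(1,3)] n(2) by (auto simp: div_le_mono Suc_le_eq)
    qed
  qed (auto simp: mangoldt_nonneg)
  also have "\<dots> = (\<Sum>m\<in>?V. \<Sum>d=1..x div m. mangoldt d)"
    by (subst sum.Sigma) auto
  also have "\<dots> \<le> (\<Sum>m\<in>?V. 6 * (real x / real m))"
  proof (intro sum_mono)
    fix m
    have "(\<Sum>d=1..x div m. mangoldt d :: real) \<le> 6 * real (x div m)" by (rule chebyshev_upper)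
    also have "\<dots> \<le> 6 * (real x / real m)" by (intro mult_left_mono of_nat_div_le_of_nat) auto
    finally show "(\<Sum>d=1..x div m. mangoldt d :: real) \<le> 6 * (real x / real m)" .
  qed
  finally show ?thesis by (simp add: sum_distrib_left)
qed

text \<open>Above \<open>sqrt x\<close> the weight \<open>ln n\<close> is at least \<open>ln x / 2\<close>, so the previous two lemmas pass from
  logarithmic to natural density; the numbers up to \<open>sqrt x\<close> are few enough to be counted trivially.
  The range starts already at \<open>x = z\<close>, which the gcd sum needs.\<close>
lemma card_rough_upper:
  assumes "y \<ge> 1" "z \<ge> y ^ 2" "z \<ge> 3" "x \<ge> z"
  shows "real (card (rough y z \<inter> {..x})) \<le> 74 * real y * (real x / ln (real z))"
proof -
  let ?V = "rough y z \<inter> {..x}"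
  let ?L = "{n\<in>?V. sqrt (real x) < real n}" and ?S = "{n\<in>?V. real n \<le> sqrt (real x)}"
  have lz: "0 < ln (real z)" "ln (real z) \<le> ln (real x)" using assms by auto
  have x: "x \<ge> 1" using assms by simp
  have "(ln (real x) / 2) * real (card ?L) = (\<Sum>n\<in>?L. ln (sqrt (real x)))"
    using x by (simp add: ln_sqrt)
  also have "\<dots> \<le> (\<Sum>n\<in>?L. ln (real n))" using x by (intro sum_mono ln_mono) auto
  also have "\<dots> \<le> (\<Sum>n\<in>?V. ln (real n))" by (intro sum_mono2) (auto dest: rough_pos)
  also have "\<dots> \<le> 6 * real x * (\<Sum>m\<in>?V. 1 / real m)" by (rule sum_rough_ln_upper)
  also have "\<dots> \<le> 6 * real x * (6 * real y * ln (real x) / ln (real z))"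
    using assms by (intro mult_left_mono sum_rough_reciprocals_upper) auto
  finally have "real (card ?L) \<le> 72 * real y * (real x / ln (real z))"
    using lz by (simp add: field_simps)
  moreover have "real (card ?S) \<le> 2 * real y * (real x / ln (real z))"
  proof -
    have "?S \<subseteq> {1..nat \<lfloor>sqrt (real x)\<rfloor>}" by (auto simp: le_nat_floor Suc_le_eq dest: rough_pos)
    then have "card ?S \<le> nat \<lfloor>sqrt (real x)\<rfloor>" by (metis card_atLeastAtMost card_mono diff_Suc_1 finite_atLeastAtMost One_nat_def)
    then have "real (card ?S) \<le> real (nat \<lfloor>sqrt (real x)\<rfloor>)" by (rule of_nat_mono)
    also have "\<dots> \<le> sqrt (real x)" by (intro of_nat_floor) auto
    also have "sqrt (real x) \<le> 2 * (real x / ln (real z))"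
    proof -
      have "ln (sqrt (real x)) \<le> sqrt (real x)" using x by (intro less_imp_le ln_less_self) auto
      then have "ln (real z) \<le> 2 * sqrt (real x)" using lz x by (simp add: ln_sqrt)
      then have "sqrt (real x) * ln (real z) \<le> sqrt (real x) * (2 * sqrt (real x))"
        by (intro mult_left_mono) auto
      also have "\<dots> = 2 * real x" by simp
      finally show ?thesis using lz by (simp add: field_simps)
    qed
    also have "\<dots> \<le> real y * (2 * (real x / ln (real z)))"
      using mult_right_mono[of 1 "real y" "2 * (real x / ln (real z))"] assms(1) lz by simp
    finally show ?thesis by (simp add: mult_ac)
  qed
  moreover have "card ?V \<le> card ?L + card ?S"
    by (rule order_trans[OF card_mono[of "?L \<union> ?S"] card_Un_le]) (auto simp: not_le)
  then have "real (card ?V) \<le> real (card ?L) + real (card ?S)" by linarith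
  ultimately show ?thesis by linarith
qed

text \<open>With \<open>d = gcd q r\<close>, \<open>r = d e\<close> and \<open>q = d m\<close>, all three factors are rough, \<open>m \<le> e\<close>, and
  \<open>gcd q r / r = 1/e\<close>. Dropping the coprimality of \<open>m\<close> and \<open>e\<close> leaves the sum on the right.\<close>
lemma sum_rough_gcd_le:
  fixes y z x :: nat
  defines "V \<equiv> rough y z"
  shows "(\<Sum>r\<in>V \<inter> {..x}. \<Sum>q\<in>V \<inter> {..r}. real (gcd q r) / real r)
       \<le> (\<Sum>e\<in>V \<inter> {..x}. real (card (V \<inter> {..e})) / real e * real (card (V \<inter> {..x div e})))"
proof -
  define W where "W e = real (card (V \<inter> {..e})) / real e" for e
  have pos: "n > 0" if "n \<in> V" for n using that rough_pos V_def by blast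
  have inner: "(\<Sum>q\<in>V \<inter> {..r}. real (gcd q r) / real r) \<le> (\<Sum>e | e dvd r. W e)" if r: "r \<in> V" for r
  proof -
    have r0: "r > 0" using pos r by blast
    have "(\<Sum>q\<in>V \<inter> {..r}. real (gcd q r) / real r)
        = (\<Sum>d\<in>{d. d dvd r}. \<Sum>q\<in>{q\<in>V \<inter> {..r}. gcd q r = d}. real (gcd q r) / real r)"
      using r0 by (intro sum.group [symmetric]) auto
    also have "\<dots> \<le> (\<Sum>d\<in>{d. d dvd r}. W (r div d))"
    proof (intro sum_mono)
      fix d assume "d \<in> {d. d dvd r}"
      then have d: "d dvd r" by simp
      then have d0: "d > 0" using r0 by (auto intro: Nat.gr0I)
      let ?Q = "{q\<in>V \<inter> {..r}. gcd q r = d}"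
      have dv: "d dvd q" if "q \<in> ?Q" for q using that by auto
      have "(\<lambda>q. q div d) ` ?Q \<subseteq> V \<inter> {..r div d}"
      proof clarify
        fix q assume q: "q \<in> V" "q \<le> r" "d = gcd q r"
        then have "d dvd q" by simp
        then have "q div d dvd q" by (metis dvd_div_mult_self dvd_triv_left)
        then show "q div gcd q r \<in> V \<inter> {..r div gcd q r}"
          using q rough_dvd[of q y z] by (auto simp: V_def div_le_mono)
      qed
      moreover have "inj_on (\<lambda>q. q div d) ?Q"
        by (rule inj_onI) (metis dv dvd_div_mult_self)
      ultimately have "card ?Q \<le> card (V \<inter> {..r div d})" by (intro card_inj_on_le) auto
      then have "real (card ?Q) * (real d / real r) \<le> real (card (V \<inter> {..r div d})) * (real d / real r)"
        by (intro mult_right_mono) auto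
      also have "\<dots> = W (r div d)"
        using d d0 r0 by (simp add: W_def real_of_nat_div)
      finally show "(\<Sum>q\<in>?Q. real (gcd q r) / real r) \<le> W (r div d)" by simp
    qed
    also have "\<dots> = (\<Sum>e | e dvd r. W e)"
      by (rule sum.reindex_bij_witness[of _ "\<lambda>m. r div m" "\<lambda>d. r div d"]) (use r0 in auto)
    finally show ?thesis .
  qed
  have "(\<Sum>r\<in>V \<inter> {..x}. \<Sum>q\<in>V \<inter> {..r}. real (gcd q r) / real r) \<le> (\<Sum>r\<in>V \<inter> {..x}. \<Sum>e | e dvd r. W e)"
    by (intro sum_mono inner) auto
  also have "\<dots> = (\<Sum>(r,e)\<in>(SIGMA r:V \<inter> {..x}. {e. e dvd r}). W e)"
    using pos by (subst sum.Sigma) auto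
  also have "\<dots> = (\<Sum>(e,d)\<in>(\<lambda>(r,e). (e, r div e)) ` (SIGMA r:V \<inter> {..x}. {e. e dvd r}). W e)"
  proof (subst sum.reindex)
    show "inj_on (\<lambda>(r,e). (e, r div e)) (SIGMA r:V \<inter> {..x}. {e. e dvd r})"
      by (auto simp: inj_on_def elim!: dvdE)
  qed (auto intro!: sum.cong)
  also have "\<dots> \<le> (\<Sum>(e,d)\<in>(SIGMA e:V \<inter> {..x}. V \<inter> {..x div e}). W e)"
  proof (intro sum_mono2)
    show "(\<lambda>(r,e). (e, r div e)) ` (SIGMA r:V \<inter> {..x}. {e. e dvd r}) \<subseteq> (SIGMA e:V \<inter> {..x}. V \<inter> {..x div e})"
    proof clarify
      fix r e assume r: "r \<in> V" "r \<le> x" "e dvd r"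
      have "e \<le> x" using r pos[OF r(1)] by (meson dvd_imp_le order_trans)
      moreover have "r div e dvd r" using r by (metis dvd_div_mult_self dvd_triv_left)
      ultimately show "e \<in> V \<inter> {..x} \<and> r div e \<in> V \<inter> {..x div e}"
        using rough_dvd[of r y z] r by (auto simp: V_def div_le_mono)
    qed
  qed (auto simp: W_def)
  also have "\<dots> = (\<Sum>e\<in>V \<inter> {..x}. W e * real (card (V \<inter> {..x div e})))"
    by (subst sum.Sigma [symmetric]) (auto simp: mult.commute)
  finally show ?thesis by (simp add: W_def)
qed

text \<open>For \<open>e < z\<close> the density of \<open>m \<le> e\<close> is bounded by \<open>1\<close>, but the rough numbers up to \<open>z\<close> have bounded
  reciprocal sum, which gives \<open>x / ln z\<close>. For \<open>e \<ge> z\<close> each of \<open>d\<close>, \<open>e\<close>, \<open>m\<close> saves a factor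
  \<open>ln z\<close>, against one factor \<open>ln x\<close> from summing over \<open>d\<close>. The two terms balance when \<open>ln z\<close> is
  of order \<open>sqrt (ln x)\<close>.\<close>
lemma sum_rough_gcd_upper:
  assumes "y \<ge> 1" "z \<ge> y ^ 2" "z \<ge> 3" "x \<ge> z ^ 2"
  shows "(\<Sum>r\<in>rough y z \<inter> {..x}. \<Sum>q\<in>rough y z \<inter> {..r}. real (gcd q r) / real r)
       \<le> 40000 * real y ^ 3 * real x * (1 / ln (real z) + ln (real x) / ln (real z) ^ 3)"
proof -
  define V where "V = rough y z"
  define C where "C = 74 * real y"
  define l where "l = ln (real z)"
  have "ln (exp 1) \<le> l" unfolding l_def using assms exp_le by (intro ln_mono) auto
  then have l: "l \<ge> 1" by simp
  have zx: "z \<le> x" using assms by (meson dual_order.trans power2_nat_le_imp_le le_square power2_eq_square order_refl self_le_power one_le_numeral pos2)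
  have pos: "n > 0" if "n \<in> V" for n using that rough_pos V_def by blast
  have cardV: "real (card (V \<inter> {..t})) \<le> C * (real t / l)" if "t \<ge> z" for t
    using card_rough_upper[OF assms(1-3) that] by (simp add: V_def C_def l_def)
  have C: "C \<ge> 74" using assms by (simp add: C_def)
  have div_le: "C * (real (x div e) / l) \<le> C * (real x / l) * (1 / real e)" for e
  proof -
    have "C * (real (x div e) / l) \<le> C * ((real x / real e) / l)"
      using C l of_nat_div_le_of_nat[of x e] by (intro mult_left_mono divide_right_mono) auto
    then show ?thesis by (simp add: mult_ac)
  qed
  let ?f = "\<lambda>e. real (card (V \<inter> {..e})) / real e * real (card (V \<inter> {..x div e}))"
  have small: "(\<Sum>e\<in>V \<inter> {..<z}. ?f e) \<le> C * (real x / l) * (6 * real y)"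
  proof -
    have "(\<Sum>e\<in>V \<inter> {..<z}. ?f e) \<le> (\<Sum>e\<in>V \<inter> {..<z}. C * (real x / l) * (1 / real e))"
    proof (intro sum_mono)
      fix e assume e: "e \<in> V \<inter> {..<z}"
      then have e0: "e > 0" using pos by blast
      have "card (V \<inter> {..e}) \<le> card {1..e}" using pos by (intro card_mono) (auto simp: Suc_le_eq)
      then have 1: "real (card (V \<inter> {..e})) / real e \<le> 1" using e0 by simp
      have "z * e \<le> z * z" using e by (intro mult_le_mono) auto
      then have "z * e \<le> x" using assms(4) by (simp only: power2_eq_square)
      then have "z \<le> x div e" using e0 by (simp add: less_eq_div_iff_mult_less_eq)
      then have "real (card (V \<inter> {..x div e})) \<le> C * (real (x div e) / l)" by (rule cardV)
      also note div_le
      finally have 2: "real (card (V \<inter> {..x div e})) \<le> C * (real x / l) * (1 / real e)" .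
      show "?f e \<le> C * (real x / l) * (1 / real e)"
        using mult_mono[OF 1 2] by simp
    qed
    also have "\<dots> \<le> C * (real x / l) * (\<Sum>e\<in>V \<inter> {..z}. 1 / real e)"
      unfolding sum_distrib_left[symmetric] using C l by (intro mult_left_mono sum_mono2) auto
    also have "\<dots> \<le> C * (real x / l) * (6 * real y * ln (real z) / ln (real z))"
      unfolding V_def using C l assms by (intro mult_left_mono sum_rough_reciprocals_upper) auto
    finally show ?thesis using l by (simp add: l_def)
  qed
  have large: "(\<Sum>e\<in>V \<inter> {z..x}. ?f e) \<le> (C / l) * (C * (real x / l) * (6 * real y * ln (real x) / l))"
  proof -
    have W: "(\<Sum>e\<in>V \<inter> {z..x}. ?f e) \<le> (\<Sum>e\<in>V \<inter> {z..x}. (C / l) * real (card (V \<inter> {..x div e})))"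
    proof (intro sum_mono mult_right_mono)
      fix e assume e: "e \<in> V \<inter> {z..x}"
      then show "real (card (V \<inter> {..e})) / real e \<le> C / l"
        using cardV[of e] pos[of e] by (simp add: field_simps)
    qed auto
    have "(\<Sum>e\<in>V \<inter> {z..x}. real (card (V \<inter> {..x div e})))
             = (\<Sum>(e,d)\<in>(SIGMA e:V \<inter> {z..x}. V \<inter> {..x div e}). 1)"
      by (subst sum.Sigma [symmetric]) auto
    also have "\<dots> = (\<Sum>(d,e)\<in>(\<lambda>(e,d). (d,e)) ` (SIGMA e:V \<inter> {z..x}. V \<inter> {..x div e}). 1)"
      by (subst sum.reindex) (auto simp: inj_on_def case_prod_unfold)
    also have "\<dots> \<le> (\<Sum>(d,e)\<in>(SIGMA d:V \<inter> {..x div z}. V \<inter> {..x div d}). 1)"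
    proof (intro sum_mono2)
      show "(\<lambda>(e,d). (d,e)) ` (SIGMA e:V \<inter> {z..x}. V \<inter> {..x div e}) \<subseteq> (SIGMA d:V \<inter> {..x div z}. V \<inter> {..x div d})"
      proof clarify
        fix e d assume *: "e \<in> V" "e \<in> {z..x}" "d \<in> V" "d \<le> x div e"
        then have "d * e \<le> x" using pos[of e] by (simp add: less_eq_div_iff_mult_less_eq)
        moreover have "d * z \<le> x" 
          using * \<open>d * e \<le> x\<close> by (meson atLeastAtMost_iff mult_le_mono2 order_trans)
        ultimately show "d \<in> V \<inter> {..x div z} \<and> e \<in> V \<inter> {..x div d}"
          using * pos[of d] pos[of e] assms(3) by (auto simp: less_eq_div_iff_mult_less_eq mult.commute)
      qed
    qed auto
    also have "\<dots> = (\<Sum>d\<in>V \<inter> {..x div z}. real (card (V \<inter> {..x div d})))"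
      by (subst sum.Sigma [symmetric]) auto
    also have "\<dots> \<le> (\<Sum>d\<in>V \<inter> {..x div z}. C * (real x / l) * (1 / real d))"
    proof (intro sum_mono)
      fix d assume d: "d \<in> V \<inter> {..x div z}"
      then have "z \<le> x div d" using pos[of d] assms(3) by (auto simp: less_eq_div_iff_mult_less_eq mult.commute)
      then have "real (card (V \<inter> {..x div d})) \<le> C * (real (x div d) / l)" by (rule cardV)
      also note div_le
      finally show "real (card (V \<inter> {..x div d})) \<le> C * (real x / l) * (1 / real d)" .
    qed
    also have "\<dots> \<le> C * (real x / l) * (\<Sum>d\<in>V \<inter> {..x}. 1 / real d)"
      unfolding sum_distrib_left[symmetric] using C l
      by (intro mult_left_mono sum_mono2) (auto intro: order_trans[OF _ div_le_dividend[of x z]])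
    also have "\<dots> \<le> C * (real x / l) * (6 * real y * ln (real x) / ln (real z))"
      unfolding V_def using C l assms zx by (intro mult_left_mono sum_rough_reciprocals_upper) auto
    finally have "(C / l) * (\<Sum>e\<in>V \<inter> {z..x}. real (card (V \<inter> {..x div e})))
      \<le> (C / l) * (C * (real x / l) * (6 * real y * ln (real x) / l))"
      using C l by (intro mult_left_mono) (auto simp: l_def)
    with W show ?thesis by (simp only: sum_distrib_left)
  qed
  have "(\<Sum>r\<in>V \<inter> {..x}. \<Sum>q\<in>V \<inter> {..r}. real (gcd q r) / real r) \<le> (\<Sum>e\<in>V \<inter> {..x}. ?f e)"
    unfolding V_def by (rule sum_rough_gcd_le)
  also have "(\<Sum>e\<in>V \<inter> {..x}. ?f e) = (\<Sum>e\<in>V \<inter> {..<z}. ?f e) + (\<Sum>e\<in>V \<inter> {z..x}. ?f e)"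
  proof -
    have "V \<inter> {..x} = (V \<inter> {..<z}) \<union> (V \<inter> {z..x})" using zx by auto
    then show ?thesis by (simp only:) (rule sum.union_disjoint, auto)
  qed
  also have "\<dots> \<le> C * (real x / l) * (6 * real y) + (C / l) * (C * (real x / l) * (6 * real y * ln (real x) / l))"
    by (intro add_mono small large)
  also have "\<dots> \<le> 40000 * real y ^ 3 * real x * (1 / l + ln (real x) / l ^ 3)"
  proof -
    have y: "real y ^ 2 \<le> real y ^ 3" using assms by (intro power_increasing) auto
    have lx: "ln (real x) \<ge> 0" using zx assms by simp
    have "C * (real x / l) * (6 * real y) = 444 * real y ^ 2 * (real x * (1 / l))"
      by (simp add: C_def power2_eq_square)
    also have "\<dots> \<le> 40000 * real y ^ 3 * (real x * (1 / l))"
      using y l by (intro mult_right_mono mult_mono) auto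
    finally have 1: "C * (real x / l) * (6 * real y) \<le> 40000 * real y ^ 3 * (real x * (1 / l))" .
    have "(C / l) * (C * (real x / l) * (6 * real y * ln (real x) / l)) 
        = 32856 * real y ^ 3 * (real x * (ln (real x) / l ^ 3))"
      by (simp add: C_def power3_eq_cube mult_ac)
    also have "\<dots> \<le> 40000 * real y ^ 3 * (real x * (ln (real x) / l ^ 3))"
      using l lx by (intro mult_right_mono) auto
    finally show ?thesis using 1 by (simp add: algebra_simps)
  qed
  finally show ?thesis by (simp add: V_def l_def)
qed

section \<open>Rough numbers in a residue class\<close>

text \<open>The representative is taken in \<open>{1..m}\<close> rather than \<open>{0..<m}\<close> so that the class in \<open>{1..x}\<close> is
  \<open>c, c + m, c + 2m, \<dots>\<close> with no exception at \<open>0\<close>.\<close>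
lemma card_residue_class:
  assumes "c \<in> {1..m}"
  shows "card {n\<in>{1..x}. [n = c] (mod m)} = (x + m - c) div m"
proof -
  have m: "m > 0" using assms by auto
  have "bij_betw (\<lambda>k. c + k * m) {..<(x + m - c) div m} {n\<in>{1..x}. [n = c] (mod m)}"
  proof (rule bij_betwI')
    fix k assume "k \<in> {..<(x + m - c) div m}"
    then have "(k + 1) * m \<le> x + m - c" using m
      by (metis Suc_eq_plus1 Suc_leI lessThan_iff less_eq_div_iff_mult_less_eq)
    then have "c + k * m \<le> x" using assms by auto
    then show "c + k * m \<in> {n\<in>{1..x}. [n = c] (mod m)}"
      using assms by (auto simp: cong_def)
  next
    fix n assume n: "n \<in> {n\<in>{1..x}. [n = c] (mod m)}"
    have "c \<le> n"
    proof (rule ccontr)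
      assume "\<not> c \<le> n"
      then have "n < m" "n \<noteq> 0" "n < c" using n assms by auto
      then have "n = c mod m" using n by (simp add: cong_def)
      then show False using \<open>n < c\<close> \<open>n \<noteq> 0\<close> assms by (cases "c = m") auto
    qed
    then have "m dvd n - c" using n by (simp add: cong_altdef_nat)
    then obtain k where "n - c = m * k" by (rule dvdE)
    then have k: "n = c + k * m" using \<open>c \<le> n\<close> by (simp add: mult.commute)
    then have "(k + 1) * m \<le> x + m - c" using n assms by auto
    then have "k + 1 \<le> (x + m - c) div m" using m by (simp add: less_eq_div_iff_mult_less_eq)
    then have "k \<in> {..<(x + m - c) div m}" by simp
    with k show "\<exists>k\<in>{..<(x + m - c) div m}. n = c + k * m" by blast
  qed (use m in auto)
  from bij_betw_same_card[OF this] show ?thesis by simp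
qed

lemma card_residue_class_approx:
  assumes "m \<ge> 1"
  shows "\<bar>real (card {n\<in>{1..x}. [n = c] (mod m)}) - real x / real m\<bar> \<le> 1"
proof -
  define c' where "c' = (if c mod m = 0 then m else c mod m)"
  have c': "c' \<in> {1..m}" "[c' = c] (mod m)" using assms
    by (auto simp: c'_def cong_def Suc_le_eq less_imp_le)
  have "{n\<in>{1..x}. [n = c] (mod m)} = {n\<in>{1..x}. [n = c'] (mod m)}"
    using c'(2) by (auto simp: cong_def)
  then have eq: "card {n\<in>{1..x}. [n = c] (mod m)} = (x + m - c') div m"
    using card_residue_class[OF c'(1)] by simp
  define k where "k = (x + m - c') div m"
  have "k * m \<le> x + m - c'" unfolding k_def by (rule div_times_less_eq_dividend)
  then have "k * m + c' \<le> x + m" using c' by auto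
  then have 1: "real k * real m + real c' \<le> real x + real m"
    by (metis of_nat_add of_nat_le_iff of_nat_mult)
  have "x + m - c' < (k + 1) * m" using dividend_less_div_times[of m "x + m - c'"] assms unfolding k_def by (simp add: algebra_simps)
  then have "x + m < (k + 1) * m + c'" using c' by auto
  then have "real x + real m < (real k + 1) * real m + real c'"
    by (metis of_nat_add of_nat_less_iff of_nat_mult of_nat_1)
  moreover have "real c' \<le> real m" using c' by auto
  ultimately have "\<bar>real k * real m - real x\<bar> \<le> real m" using 1 by (simp add: algebra_simps abs_le_iff)
  then have "\<bar>(real k - real x / real m) * real m\<bar> \<le> 1 * real m" using assms by (simp add: algebra_simps)
  then have "\<bar>real k - real x / real m\<bar> \<le> 1" using assms
    by (simp only: abs_mult abs_of_nat) (simp add: mult_le_cancel_right)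
  then show ?thesis by (simp only: eq k_def)
qed

text \<open>For \<open>d \<le> x\<close> the error is at most \<open>1\<close>, for \<open>d > x\<close> it is at most \<open>x/d\<close>. Rankin's trick bounds both
  by the single multiplicative expression \<open>(x/d)\<^bsup>1-\<sigma>\<^esup>\<close>, so that the error of the sieve becomes an Euler
  product.\<close>
lemma card_multiples_in_class_approx:
  fixes d x y z\<^sub>0 :: nat and \<sigma> :: real
  assumes "y \<ge> 1" "d \<ge> 1" "x \<ge> 1" "coprime d y" "0 \<le> \<sigma>" "\<sigma> \<le> 1"
  shows "\<bar>real (card {n\<in>{1..x}. [n = z\<^sub>0] (mod y) \<and> d dvd n}) - real x / (real y * real d)\<bar>
           \<le> (real x / real d) powr (1 - \<sigma>)"
proof (cases "d \<le> x")
  case True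
  obtain n\<^sub>0 where n0: "[n\<^sub>0 = z\<^sub>0] (mod y)" "[n\<^sub>0 = 0] (mod d)"
    using binary_chinese_remainder_nat[of y d z\<^sub>0 0] assms(4) by (auto simp: coprime_commute)
  have "[n = z\<^sub>0] (mod y) \<and> d dvd n \<longleftrightarrow> [n = n\<^sub>0] (mod (y * d))" for n
  proof -
    have "[n = n\<^sub>0] (mod (y * d)) \<longleftrightarrow> [n = n\<^sub>0] (mod y) \<and> [n = n\<^sub>0] (mod d)"
      using coprime_cong_mult_nat[of n n\<^sub>0 y d] cong_modulus_mult_nat[of n n\<^sub>0 y d]
        cong_modulus_mult_nat[of n n\<^sub>0 d y] assms(4) by (auto simp: coprime_commute mult.commute)
    also have "\<dots> \<longleftrightarrow> [n = z\<^sub>0] (mod y) \<and> [n = 0] (mod d)"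
      using n0 by (auto simp: cong_def)
    finally show ?thesis by (simp add: cong_0_iff)
  qed
  then have "\<bar>real (card {n\<in>{1..x}. [n = z\<^sub>0] (mod y) \<and> d dvd n}) - real x / (real y * real d)\<bar> \<le> 1"
    using card_residue_class_approx[of "y * d" x n\<^sub>0] assms by simp
  also have "1 \<le> (real x / real d) powr (1 - \<sigma>)"
    using True assms by (intro ge_one_powr_ge_zero) auto
  finally show ?thesis .
next
  case False
  then have "{n\<in>{1..x}. [n = z\<^sub>0] (mod y) \<and> d dvd n} = {}" by (auto dest: dvd_imp_le)
  then have "\<bar>real (card {n\<in>{1..x}. [n = z\<^sub>0] (mod y) \<and> d dvd n}) - real x / (real y * real d)\<bar>
      = real x / (real y * real d)" by (simp only:) simp
  also have "\<dots> \<le> real x / (1 * real d)"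
    using assms by (intro divide_left_mono mult_right_mono) auto
  also have "\<dots> = (real x / real d) powr 1" using assms by simp
  also have "\<dots> \<le> (real x / real d) powr (1 - \<sigma>)"
    using False assms by (intro powr_mono') auto
  finally show ?thesis .
qed

lemma prod_primes_dvd_iff:
  assumes "finite X" "\<And>p. p \<in> X \<Longrightarrow> prime p"
  shows "\<Prod>X dvd (n :: nat) \<longleftrightarrow> (\<forall>p\<in>X. p dvd n)"
  using assms
proof (induction X rule: finite_induct)
  case (insert p X)
  have "coprime p (\<Prod>X)"
    using insert by (intro prod_coprime_right) (auto intro!: primes_coprime)
  then have "p * \<Prod>X dvd n \<longleftrightarrow> p dvd n \<and> \<Prod>X dvd n"
    by (meson divides_mult dvd_mult_left dvd_mult_right)
  with insert show ?case by simp
qed auto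

text \<open>Legendre's sieve: inclusion-exclusion over all sets \<open>X\<close> of primes to be avoided, each count being
  replaced by its main term with the error bound of \<open>card_multiples_in_class_approx\<close>. Both the main terms and the errors sum to
  products over \<open>P\<close>.\<close>
lemma sieve_lower:
  fixes x y z z\<^sub>0 :: nat and \<sigma> :: real
  defines "P \<equiv> {p. prime p \<and> p \<le> z \<and> \<not> p dvd y}"
  assumes "y \<ge> 1" "x \<ge> 1" "0 \<le> \<sigma>" "\<sigma> \<le> 1"
  shows "real x / real y * (\<Prod>p\<in>P. 1 - 1 / real p) - real x powr (1 - \<sigma>) * (\<Prod>p\<in>P. 1 + real p powr (\<sigma> - 1))
       \<le> real (card {n\<in>rough y z \<inter> {..x}. [n = z\<^sub>0] (mod y)})"
proof -
  have finP: "finite P" by (simp add: P_def)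
  define N where "N X = real (card {n\<in>{1..x}. [n = z\<^sub>0] (mod y) \<and> \<Prod>X dvd n})" for X
  have X: "finite X" "\<And>p. p \<in> X \<Longrightarrow> prime p" "\<Prod>X \<ge> 1" "coprime (\<Prod>X) y" if "X \<in> Pow P" for X
  proof -
    show 1: "finite X" using that finP finite_subset by blast
    show 2: "prime p" if "p \<in> X" for p using that \<open>X \<in> Pow P\<close> by (auto simp: P_def)
    show "\<Prod>X \<ge> 1" using 1 2 by (auto simp: Suc_le_eq intro!: prod_pos dest: prime_gt_0_nat)
    show "coprime (\<Prod>X) y" using that
      by (intro prod_coprime_left) (auto simp: P_def intro: prime_imp_coprime)
  qed
  have ind: "(\<Sum>X\<in>Pow P. (-1) ^ card X * of_bool (\<Prod>X dvd n)) = (of_bool (n \<in> rough y z) :: real)"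
    if "n \<ge> 1" for n
  proof -
    have "(\<Sum>X\<in>Pow P. (-1) ^ card X * of_bool (\<Prod>X dvd n))
        = (\<Sum>X\<in>Pow P. (\<Prod>p\<in>X. - of_bool (p dvd n)) * (\<Prod>p\<in>P - X. (1::real)))"
    proof (rule sum.cong[OF refl])
      fix Y assume "Y \<in> Pow P"
      note Y = X[OF this]
      have "(of_bool (\<Prod>Y dvd n) :: real) = (\<Prod>p\<in>Y. of_bool (p dvd n))"
        using Y prod_primes_dvd_iff[of Y n] by (auto simp: prod_zero_iff)
      then show "(-1) ^ card Y * of_bool (\<Prod>Y dvd n) 
          = (\<Prod>p\<in>Y. - of_bool (p dvd n)) * (\<Prod>p\<in>P - Y. (1::real))"
        by (simp add: prod_uminus)
    qed
    also have "\<dots> = (\<Prod>p\<in>P. - of_bool (p dvd n) + 1)" by (rule prod_add[OF finP, symmetric])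
    also have "\<dots> = of_bool (n \<in> rough y z)"
    proof (cases "n \<in> rough y z")
      case True
      then show ?thesis by (auto simp: P_def rough_def intro!: prod.neutral)
    next
      case False
      then obtain p where "prime p" "p dvd n" "p \<le> z" "\<not> p dvd y"
        using \<open>n \<ge> 1\<close> by (auto simp: rough_def)
      then show ?thesis using False finP by (auto simp: prod_zero_iff P_def intro!: bexI[of _ p])
    qed
    finally show ?thesis .
  qed
  have "real (card {n\<in>rough y z \<inter> {..x}. [n = z\<^sub>0] (mod y)})
      = (\<Sum>n\<in>{n\<in>{1..x}. [n = z\<^sub>0] (mod y)}. of_bool (n \<in> rough y z))"
  proof -
    have "{n\<in>rough y z \<inter> {..x}. [n = z\<^sub>0] (mod y)} = {n\<in>{1..x}. [n = z\<^sub>0] (mod y)} \<inter> {n. n \<in> rough y z}"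
      by (auto simp: Suc_le_eq dest: rough_pos)
    then show ?thesis by (simp only: sum_of_bool_eq finite_Collect_conjI finite_atLeastAtMost Collect_mem_eq finite_Int simp_thms)
  qed
  also have "\<dots> = (\<Sum>n\<in>{n\<in>{1..x}. [n = z\<^sub>0] (mod y)}. \<Sum>X\<in>Pow P. (-1) ^ card X * of_bool (\<Prod>X dvd n))"
    by (intro sum.cong refl ind [symmetric]) auto
  also have "\<dots> = (\<Sum>X\<in>Pow P. (-1) ^ card X * N X)"
  proof (subst sum.swap, rule sum.cong[OF refl])
    fix X assume "X \<in> Pow P"
    have "{n\<in>{1..x}. [n = z\<^sub>0] (mod y)} \<inter> {n. \<Prod>X dvd n} = {n\<in>{1..x}. [n = z\<^sub>0] (mod y) \<and> \<Prod>X dvd n}" by auto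
    then have "(\<Sum>n\<in>{n\<in>{1..x}. [n = z\<^sub>0] (mod y)}. of_bool (\<Prod>X dvd n)) = N X"
      by (simp add: N_def sum_of_bool_eq)
    then show "(\<Sum>n\<in>{n\<in>{1..x}. [n = z\<^sub>0] (mod y)}. (-1) ^ card X * of_bool (\<Prod>X dvd n)) = (-1) ^ card X * N X"
      by (simp only: sum_distrib_left [symmetric])
  qed
  finally have L: "real (card {n\<in>rough y z \<inter> {..x}. [n = z\<^sub>0] (mod y)}) = (\<Sum>X\<in>Pow P. (-1) ^ card X * N X)" .
  have main: "(\<Sum>X\<in>Pow P. (-1) ^ card X * (real x / (real y * real (\<Prod>X)))) 
      = real x / real y * (\<Prod>p\<in>P. 1 - 1 / real p)"
  proof -
    have "(\<Prod>p\<in>P. 1 - 1 / real p) = (\<Prod>p\<in>P. - (1 / real p) + 1)" by simp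
    also have "\<dots> = (\<Sum>X\<in>Pow P. (-1) ^ card X / real (\<Prod>X))"
      by (subst prod_add[OF finP]) (auto simp: prod_uminus prod_dividef)
    finally have e: "(\<Prod>p\<in>P. 1 - 1 / real p) = (\<Sum>X\<in>Pow P. (-1) ^ card X / real (\<Prod>X))" .
    have "(\<Sum>X\<in>Pow P. (-1) ^ card X * (real x / (real y * real (\<Prod>X)))) 
        = (\<Sum>X\<in>Pow P. real x / real y * ((-1) ^ card X / real (\<Prod>X)))"
      by (intro sum.cong refl) (simp add: mult_ac)
    then show ?thesis unfolding e by (simp only: sum_distrib_left)
  qed
  have err: "(\<Sum>X\<in>Pow P. (real x / real (\<Prod>X)) powr (1 - \<sigma>)) 
      = real x powr (1 - \<sigma>) * (\<Prod>p\<in>P. 1 + real p powr (\<sigma> - 1))"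
  proof -
    have "(\<Prod>p\<in>P. 1 + real p powr (\<sigma> - 1)) = (\<Sum>X\<in>Pow P. real (\<Prod>X) powr (\<sigma> - 1))"
      by (subst add.commute, subst prod_add[OF finP]) (auto simp: prod_powr_distrib)
    moreover have "(real x / real (\<Prod>X)) powr (1 - \<sigma>) = real x powr (1 - \<sigma>) * real (\<Prod>X) powr (\<sigma> - 1)" for X
    proof -
      have "(real x / real (\<Prod>X)) powr (1 - \<sigma>) = real x powr (1 - \<sigma>) / real (\<Prod>X) powr (1 - \<sigma>)"
        by (rule powr_divide)
      also have "\<dots> = real x powr (1 - \<sigma>) * real (\<Prod>X) powr (- (1 - \<sigma>))"
        by (simp only: powr_minus divide_inverse)
      finally show ?thesis by simp
    qed
    ultimately show ?thesis by (simp add: sum_distrib_left)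
  qed
  have "real x / real y * (\<Prod>p\<in>P. 1 - 1 / real p) - (\<Sum>X\<in>Pow P. (-1) ^ card X * N X)
      = (\<Sum>X\<in>Pow P. (-1) ^ card X * (real x / (real y * real (\<Prod>X)) - N X))"
    unfolding main [symmetric] by (simp only: right_diff_distrib sum_subtractf)
  also have "\<dots> \<le> (\<Sum>X\<in>Pow P. (real x / real (\<Prod>X)) powr (1 - \<sigma>))"
  proof (intro sum_mono)
    fix Y assume "Y \<in> Pow P"
    note Y = X[OF this]
    have "(-1) ^ card Y * (real x / (real y * real (\<Prod>Y)) - N Y) \<le> \<bar>N Y - real x / (real y * real (\<Prod>Y))\<bar>"
    proof -
      have "(-1) ^ n * u \<le> \<bar>- u\<bar>" for n :: nat and u :: real by (cases "even n") auto
      then show ?thesis by (metis minus_diff_eq)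
    qed
    also have "\<dots> \<le> (real x / real (\<Prod>Y)) powr (1 - \<sigma>)"
      unfolding N_def using assms Y by (intro card_multiples_in_class_approx) auto
    finally show "(-1) ^ card Y * (real x / (real y * real (\<Prod>Y)) - N Y) \<le> (real x / real (\<Prod>Y)) powr (1 - \<sigma>)" .
  qed
  finally show ?thesis unfolding L err by linarith
qed

text \<open>Choose \<open>\<sigma> = 1 / ln z\<close>. Then \<open>p\<^sup>\<sigma> \<le> 3\<close> for \<open>p \<le> z\<close>, and the trivial bound
  \<open>1 + ln z\<close> for the sum of \<open>1/p\<close> shows that the error product is at most \<open>exp (3 + 3 ln z)\<close>. Since
  \<open>ln x \<ge> 8 (ln z)\<^sup>2\<close>, the factor \<open>x\<^sup>-\<^sup>\<sigma> \<le> exp (- 8 ln z)\<close> beats it, and Mertens' product gives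
  the main term.\<close>
lemma rough_class_lower:
  assumes "y \<ge> 1"
  shows "\<exists>c>0. \<exists>Z. \<forall>z\<ge>Z. \<forall>x\<ge>1. ln (real x) \<ge> 8 * ln (real z) ^ 2 \<longrightarrow>
           c * (real x / ln (real z)) \<le> real (card {n\<in>rough y z \<inter> {..x}. [n = z\<^sub>0] (mod y)})"
proof -
  obtain c where c: "c > 0" "\<And>n. n \<ge> 2 \<Longrightarrow> c / ln (real n) \<le> (\<Prod>p | prime p \<and> p \<le> n. 1 - 1 / real p)"
    using mertens_product_lower by blast
  define Z where "Z = max 3 (nat \<lceil>2 * real y * exp 3 / c\<rceil>)"
  have "c / (2 * real y) * (real x / ln (real z)) \<le> real (card {n\<in>rough y z \<inter> {..x}. [n = z\<^sub>0] (mod y)})"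
    if z: "z \<ge> Z" and x: "x \<ge> 1" and xz: "ln (real x) \<ge> 8 * ln (real z) ^ 2" for x z
  proof -
    define P where "P = {p. prime p \<and> p \<le> z \<and> \<not> p dvd y}"
    define l where "l = ln (real z)"
    define \<sigma> where "\<sigma> = 1 / l"
    have z3: "z \<ge> 3" using z by (simp add: Z_def)
    then have "ln (exp 1) \<le> l" unfolding l_def using exp_le by (intro ln_mono) auto
    then have l: "l \<ge> 1" by simp
    have main: "c / l \<le> (\<Prod>p\<in>P. 1 - 1 / real p)"
    proof -
      have "c / l \<le> (\<Prod>p | prime p \<and> p \<le> z. 1 - 1 / real p)" using c(2) z3 by (simp add: l_def)
      also have "\<dots> \<le> (\<Prod>p\<in>P. 1 - 1 / real p)"
      proof -
        let ?B = "{p. prime p \<and> p \<le> z}"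
        have nn: "0 \<le> 1 - 1 / real p" if "p \<in> ?B" for p
          using that prime_ge_1_nat[of p] by auto
        have "(\<Prod>p\<in>?B. 1 - 1 / real p) = (\<Prod>p\<in>?B - P. 1 - 1 / real p) * (\<Prod>p\<in>P. 1 - 1 / real p)"
          by (intro prod.subset_diff) (auto simp: P_def)
        also have "\<dots> \<le> 1 * (\<Prod>p\<in>P. 1 - 1 / real p)"
          using nn by (intro mult_right_mono prod_le_1 prod_nonneg conjI) (auto simp: P_def)
        finally show ?thesis by simp
      qed
      finally show ?thesis .
    qed
    have err: "(\<Prod>p\<in>P. 1 + real p powr (\<sigma> - 1)) \<le> exp (3 + 3 * l)"
    proof -
      have "(\<Prod>p\<in>P. 1 + real p powr (\<sigma> - 1)) \<le> (\<Prod>p\<in>P. exp (3 * (1 / real p)))"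
      proof (intro prod_mono conjI)
        fix p assume "p \<in> P"
        then have p: "p \<ge> 2" "p \<le> z" by (auto simp: P_def prime_ge_2_nat)
        have "real p powr \<sigma> = exp (\<sigma> * ln (real p))" using p by (simp add: powr_def)
        also have "\<dots> \<le> exp (\<sigma> * l)" unfolding l_def[symmetric]
          using p l by (simp add: \<sigma>_def l_def divide_right_mono)
        also have "\<dots> \<le> 3" using l exp_le by (simp add: \<sigma>_def)
        finally have "real p powr (\<sigma> - 1) \<le> 3 * (1 / real p)"
          using p by (simp add: powr_diff divide_right_mono)
        then show "1 + real p powr (\<sigma> - 1) \<le> exp (3 * (1 / real p))"
          using exp_ge_add_one_self[of "3 * (1 / real p)"] by linarith
      qed auto
      also have "\<dots> = exp (3 * (\<Sum>p\<in>P. 1 / real p))"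
        by (subst exp_sum [symmetric]) (auto simp: P_def sum_distrib_left)
      also have "(\<Sum>p\<in>P. 1 / real p) \<le> (\<Sum>i=1..z. 1 / real i)"
        by (intro sum_mono2) (auto simp: P_def Suc_le_eq dest: prime_gt_0_nat)
      also have "\<dots> \<le> 1 + l" unfolding l_def using z3 by (intro sum_reciprocals_upper) auto
      finally show ?thesis by (simp add: algebra_simps)
    qed
    have powr: "real x powr (1 - \<sigma>) \<le> real x * exp (- 8 * l)"
    proof -
      have "real x powr (1 - \<sigma>) = real x * exp (- (\<sigma> * ln (real x)))"
        using x by (simp add: powr_def exp_diff algebra_simps exp_minus divide_inverse)
      also have "\<dots> \<le> real x * exp (- 8 * l)"
      proof -
        have "8 * l \<le> \<sigma> * ln (real x)"
          using xz l by (simp add: \<sigma>_def l_def [symmetric] field_simps power2_eq_square)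
        then show ?thesis by (intro mult_left_mono) auto
      qed
      finally show ?thesis by simp
    qed
    have "exp (3 - 5 * l) \<le> c / (2 * real y) / l"
    proof -
      have "2 * real y * exp 3 / c \<le> real z" using z by (simp add: Z_def)
      also have "\<dots> = exp l" using z3 by (simp add: l_def)
      finally have 1: "2 * real y * exp 3 \<le> c * exp l" using c(1) by (simp add: field_simps)
      have "2 * real y * l * exp (3 - 5 * l) = (2 * real y * exp 3) * (l * exp (- 5 * l))"
        by (simp add: exp_diff exp_minus field_simps)
      also have "\<dots> \<le> (c * exp l) * (exp l * exp (- 5 * l))"
      proof (intro mult_mono[OF 1] mult_right_mono)
        show "l \<le> exp l" using exp_ge_add_one_self[of l] by linarith
      qed (use c(1) l in auto)
      also have "\<dots> = c * exp (- 3 * l)" by (simp add: mult_exp_exp)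
      also have "\<dots> \<le> c * 1" using c(1) l by (intro mult_left_mono) auto
      finally show ?thesis using assms l by (simp add: field_simps)
    qed
    then have "real x * exp (3 - 5 * l) \<le> real x * (c / (2 * real y) / l)"
      by (intro mult_left_mono) auto
    moreover have "real x powr (1 - \<sigma>) * (\<Prod>p\<in>P. 1 + real p powr (\<sigma> - 1)) \<le> real x * exp (- 8 * l) * exp (3 + 3 * l)"
      by (intro mult_mono powr err prod_nonneg) auto
    moreover have "real x * exp (- 8 * l) * exp (3 + 3 * l) = real x * exp (3 - 5 * l)"
      by (simp add: mult_exp_exp mult.assoc)
    moreover have "real x / real y * (c / l) \<le> real x / real y * (\<Prod>p\<in>P. 1 - 1 / real p)"
      by (intro mult_left_mono main) auto
    moreover have "real x / real y * (\<Prod>p\<in>P. 1 - 1 / real p) - real x powr (1 - \<sigma>) * (\<Prod>p\<in>P. 1 + real p powr (\<sigma> - 1))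
       \<le> real (card {n\<in>rough y z \<inter> {..x}. [n = z\<^sub>0] (mod y)})"
      unfolding P_def using assms x l by (intro sieve_lower) (auto simp: \<sigma>_def)
    moreover have "c / (2 * real y) * (real x / l) = real x / real y * (c / l) - real x * (c / (2 * real y) / l)"
      using assms l by (simp add: field_simps)
    ultimately show ?thesis unfolding l_def[symmetric] by linarith
  qed
  moreover have "c / (2 * real y) > 0" using c assms by simp
  ultimately show ?thesis by blast
qed

section \<open>Partial sums under the divergence hypothesis\<close>

lemma iter_log_0 [simp]: "iter_log 0 t = t"
  and iter_log_Suc: "iter_log (Suc i) t = ln (iter_log i t)"
  and iter_log_1 [simp]: "iter_log (Suc 0) t = ln t"
  by (simp_all add: iter_log_def)

lemma iter_log_mono:
  assumes "s \<le> t" "\<And>j. j < i \<Longrightarrow> 0 < iter_log j s"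
  shows "iter_log i s \<le> iter_log i t"
  using assms(2)
proof (induction i)
  case 0 then show ?case using assms(1) by simp
next
  case (Suc i)
  then have "iter_log i s \<le> iter_log i t" "0 < iter_log i s" by auto
  then show ?case by (simp add: iter_log_Suc)
qed

lemma iter_log_pos_mono:
  assumes "s \<le> t" "\<And>j. j \<le> k \<Longrightarrow> 0 < iter_log j s" "i \<le> k"
  shows "0 < iter_log i t"
  using iter_log_mono[of s t i] assms by (meson less_le_trans less_imp_le order_trans)

lemma has_derivative_iter_log:
  assumes "\<And>j. j < i \<Longrightarrow> 0 < iter_log j t"
  shows "(iter_log i has_real_derivative 1 / (\<Prod>j<i. iter_log j t)) (at t)"
  using assms
proof (induction i)
  case 0
  have "iter_log 0 = (\<lambda>t. t)" by (simp add: fun_eq_iff)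
  then show ?case by simp
next
  case (Suc i)
  have "((\<lambda>s. ln (iter_log i s)) has_real_derivative 
      (1 / (\<Prod>j<i. iter_log j t)) * (1 / iter_log i t)) (at t)"
    using Suc by (intro derivative_eq_intros Suc.IH refl) (auto simp: field_simps)
  moreover have "iter_log (Suc i) = (\<lambda>s. ln (iter_log i s))" by (simp add: iter_log_Suc fun_eq_iff)
  ultimately show ?case by simp
qed

text \<open>The extension of \<open>log_weight\<close> to real arguments, needed for differentiation.\<close>
definition real_log_weight :: "nat \<Rightarrow> real \<Rightarrow> real \<Rightarrow> real" where
  "real_log_weight k \<delta> t = sqrt (ln t) * (\<Prod>i\<in>{2..<k}. iter_log i t) * iter_log k t powr (1 + \<delta>)"

lemma real_log_weight_pos:
  assumes "\<And>j. j \<le> k \<Longrightarrow> 0 < iter_log j t" "k \<ge> 2"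
  shows "0 < real_log_weight k \<delta> t"
proof -
  have "iter_log k t powr (1 + \<delta>) > 0" using assms(1)[OF order_refl] by simp
  then show ?thesis using assms(1)[of 1] assms unfolding real_log_weight_def
    by (intro mult_pos_pos prod_pos) auto
qed

lemma real_log_weight_mono:
  assumes "s \<le> t" "\<And>j. j \<le> k \<Longrightarrow> 0 < iter_log j s" "k \<ge> 2" "\<delta> > 0"
  shows "real_log_weight k \<delta> s \<le> real_log_weight k \<delta> t"
proof -
  have pos: "0 < iter_log i t" if "i \<le> k" for i using iter_log_pos_mono[OF assms(1,2) that] by simp
  have mono: "iter_log i s \<le> iter_log i t" if "i \<le> k" for i
    using that assms by (intro iter_log_mono) auto
  have "(\<Prod>i\<in>{2..<k}. iter_log i s) \<le> (\<Prod>i\<in>{2..<k}. iter_log i t)"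
    using assms mono by (intro prod_mono) (auto simp: less_imp_le)
  moreover have "sqrt (ln s) \<le> sqrt (ln t)" using mono[of 1] assms by simp
  moreover have "iter_log k s powr (1 + \<delta>) \<le> iter_log k t powr (1 + \<delta>)"
    using mono[of k] less_imp_le[OF assms(2)[OF order_refl]] assms(4) by (intro powr_mono2) auto
  ultimately show ?thesis
    unfolding real_log_weight_def using assms(2) assms(2)[of 1] pos[of 1] pos assms(3)
    by (intro mult_mono) (auto intro!: mult_nonneg_nonneg prod_nonneg less_imp_le[of 0 "iter_log _ _"])
qed

text \<open>The function \<open>- (log\<^sup>(\<^sup>k\<^sup>) t)\<^bsup>-\<delta>\<^esup> / \<delta>\<close> is bounded above and has derivative
  \<open>1 / (t sqrt (ln t) w(t))\<close>, where \<open>w\<close> is the weight: this is twice the derivative of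
  \<open>sqrt (ln t)\<close> divided by \<open>w(t)\<close>. As \<open>w\<close> increases, freezing it at \<open>b\<close> gives an inequality between
  increments whose right-hand sides telescope.\<close>
lemma sqrt_ln_increment_le:
  assumes "a \<le> b" "\<And>j. j \<le> k \<Longrightarrow> 0 < iter_log j a" "k \<ge> 2" "\<delta> > 0"
  shows "(sqrt (ln b) - sqrt (ln a)) / real_log_weight k \<delta> b
       \<le> (iter_log k a powr (- \<delta>) - iter_log k b powr (- \<delta>)) / (2 * \<delta>)"
proof -
  let ?g = "1 / real_log_weight k \<delta> b"
  let ?G = "\<lambda>t. - (iter_log k t powr (- \<delta>)) / (2 * \<delta>) - ?g * sqrt (ln t)"
  have "?G a \<le> ?G b"
  proof (rule DERIV_nonneg_imp_nondecreasing[OF assms(1)])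
    fix t assume t: "a \<le> t" "t \<le> b"
    have pos: "0 < iter_log i t" if "i \<le> k" for i using iter_log_pos_mono[OF t(1) assms(2) that] by simp
    have t0: "t > 0" "ln t > 0" using pos[of 0] pos[of 1] assms(3) by auto
    have P: "(\<Prod>j<k. iter_log j t) = t * ln t * (\<Prod>i\<in>{2..<k}. iter_log i t)"
    proof -
      have "{..<k} = {0, 1} \<union> {2..<k}" using assms(3) by auto
      then have "(\<Prod>j<k. iter_log j t) = (\<Prod>j\<in>{0,1}. iter_log j t) * (\<Prod>i\<in>{2..<k}. iter_log i t)"
        by (simp only:) (rule prod.union_disjoint, auto)
      then show ?thesis by simp
    qed
    have Ppos: "(\<Prod>i\<in>{2..<k}. iter_log i t) > 0" using pos by (intro prod_pos) auto
    have d1: "(iter_log k has_real_derivative 1 / (\<Prod>j<k. iter_log j t)) (at t)"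
      using pos by (intro has_derivative_iter_log) auto
    have "((\<lambda>t. iter_log k t powr (- \<delta>)) has_real_derivative
        (- \<delta>) * iter_log k t powr (- \<delta> - 1) * (1 / (\<Prod>j<k. iter_log j t))) (at t)"
      using DERIV_fun_powr[OF d1 pos[OF order_refl], of "-\<delta>"] by simp
    then have "((\<lambda>t. (- 1 / (2 * \<delta>)) * iter_log k t powr (- \<delta>)) has_real_derivative
        (- 1 / (2 * \<delta>)) * ((- \<delta>) * iter_log k t powr (- \<delta> - 1) * (1 / (\<Prod>j<k. iter_log j t)))) (at t)"
      by (rule DERIV_cmult)
    moreover have "(- 1 / (2 * \<delta>)) * ((- \<delta>) * iter_log k t powr (- \<delta> - 1) * (1 / (\<Prod>j<k. iter_log j t)))
        = iter_log k t powr (- \<delta> - 1) / (2 * (\<Prod>j<k. iter_log j t))"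
      using assms(4) by simp
    moreover have "(\<lambda>t. (- 1 / (2 * \<delta>)) * iter_log k t powr (- \<delta>)) = (\<lambda>t. - (iter_log k t powr (- \<delta>)) / (2 * \<delta>))"
      by (simp add: fun_eq_iff)
    ultimately have d2: "((\<lambda>t. - (iter_log k t powr (- \<delta>)) / (2 * \<delta>)) has_real_derivative
        iter_log k t powr (- \<delta> - 1) / (2 * (\<Prod>j<k. iter_log j t))) (at t)"
      by (simp only:)
    have wb: "0 < real_log_weight k \<delta> b"
      using iter_log_pos_mono[OF assms(1,2)] assms(3) by (intro real_log_weight_pos) auto
    have d3: "((\<lambda>t. ?g * sqrt (ln t)) has_real_derivative ?g / (2 * t * sqrt (ln t))) (at t)"
      using t0 wb by (auto intro!: derivative_eq_intros simp: field_simps)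
    have "iter_log k t powr (- \<delta> - 1) / (2 * (\<Prod>j<k. iter_log j t))
        = (1 / real_log_weight k \<delta> t) / (2 * t * sqrt (ln t))"
    proof -
      have "iter_log k t powr (- \<delta> - 1) = 1 / iter_log k t powr (1 + \<delta>)"
      proof -
        have "- \<delta> - 1 = - (1 + \<delta>)" by simp
        then show ?thesis by (simp only: powr_minus_divide)
      qed
      moreover have "ln t = sqrt (ln t) * sqrt (ln t)" using t0 by simp
      moreover have "A / (2 * (u * L * Q)) = (1 / (h * Q * B)) / (2 * u * h)"
        if "A = 1 / B" "L = h * h" for A B L h Q u :: real
        using that by (simp add: mult_ac)
      ultimately show ?thesis unfolding P real_log_weight_def by blast
    qed
    moreover have "?g / (2 * t * sqrt (ln t)) \<le> (1 / real_log_weight k \<delta> t) / (2 * t * sqrt (ln t))"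
    proof -
      have "real_log_weight k \<delta> t \<le> real_log_weight k \<delta> b"
        using t(2) pos assms(3,4) by (rule real_log_weight_mono)
      moreover have "0 < real_log_weight k \<delta> t" using pos assms(3) by (rule real_log_weight_pos)
      ultimately show ?thesis using t0 by (intro divide_right_mono) (auto simp: frac_le)
    qed
    ultimately have "0 \<le> iter_log k t powr (- \<delta> - 1) / (2 * (\<Prod>j<k. iter_log j t)) - ?g / (2 * t * sqrt (ln t))"
      by linarith
    with DERIV_diff[OF d2 d3] show "\<exists>D. DERIV ?G t :> D \<and> 0 \<le> D" by blast
  qed
  then show ?thesis by (simp add: diff_divide_distrib)
qed

text \<open>If the partial sums of \<open>\<psi>\<close> were at most \<open>M sqrt (ln n)\<close>, then by summation by parts the weighted
  series would be dominated by the sum of the increments of \<open>M sqrt (ln n)\<close> divided by the weights,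
  which converges by the telescoping bound. The exponent \<open>1 + \<delta>\<close> on the last logarithm is what makes it
  converge.\<close>
lemma weighted_series_diverges_imp_unbounded:
  assumes div: "weighted_series_diverges \<psi> k \<delta>" and "\<delta> > 0" "k \<ge> 2" and pos: "\<And>q. q \<ge> 1 \<Longrightarrow> 0 < \<psi> q"
  shows "\<exists>n\<ge>2. M * sqrt (ln (real n)) < (\<Sum>q=1..n. \<psi> q)"
proof (rule ccontr)
  assume "\<not> ?thesis"
  then have bound: "(\<Sum>q=1..n. \<psi> q) \<le> M * sqrt (ln (real n))" if "n \<ge> 2" for n
    using that by (meson not_le)
  have "0 \<le> (\<Sum>q=1..2. \<psi> q)" using pos by (intro sum_nonneg) (auto simp: less_imp_le)
  also have "\<dots> \<le> M * sqrt (ln 2)" using bound[of 2] by simp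
  finally have M: "M \<ge> 0" by (simp add: zero_le_mult_iff)
  have dom: "n \<in> log_domain k \<longleftrightarrow> (\<forall>j\<le>k. 0 < iter_log j (real n))" for n
  proof -
    have "(\<forall>j\<le>k. 0 < iter_log j (real n)) \<longleftrightarrow> 0 < real n \<and> (\<forall>j\<in>{1..k}. 0 < iter_log j (real n))"
      by (auto simp: Suc_le_eq)
    then show ?thesis by (auto simp: log_domain_def)
  qed
  have up: "n' \<in> log_domain k" if "n \<in> log_domain k" "n \<le> n'" for n n'
    using that iter_log_pos_mono[of "real n" "real n'" k] by (auto simp: dom)
  have w: "log_weight k \<delta> n = real_log_weight k \<delta> (real n)" for n
    by (simp add: log_weight_def real_log_weight_def)
  have "(\<lambda>q. \<psi> q / log_weight k \<delta> q) summable_on log_domain k"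
  proof (cases "log_domain k = {}")
    case False
    define m where "m = (LEAST n. n \<in> log_domain k)"
    have m: "m \<in> log_domain k" unfolding m_def using False by (metis LeastI ex_in_conv)
    have least: "m \<le> n" if "n \<in> log_domain k" for n unfolding m_def using that by (rule Least_le)
    have mpos: "0 < iter_log j (real n)" if "n \<ge> m" "j \<le> k" for n j using up[OF m] that by (auto simp: dom)
    have m2: "m \<ge> 2"
    proof -
      have "0 < ln (real m)" using mpos[of m 1] assms by simp
      then have "real m > 1" by (metis ln_gt_zero_iff ln_le_zero_iff mpos iter_log_0 le0 order_refl)
      then show ?thesis by simp
    qed
    let ?h = "\<lambda>n. sqrt (ln (real n))" and ?w = "\<lambda>n. 1 / real_log_weight k \<delta> (real n)"
    let ?F = "\<lambda>n. iter_log k (real n) powr (- \<delta>) / (2 * \<delta>)"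
    have wpos: "0 < real_log_weight k \<delta> (real n)" if "n \<ge> m" for n
      using mpos[OF that] assms by (intro real_log_weight_pos) auto
    define b where "b n = (if n = m then M * ?h m else M * (?h n - ?h (n - 1)))" for n
    have sb: "(\<Sum>i=m..n. b i) = M * ?h n" if "n \<ge> m" for n
      using that by (induction n rule: dec_induct) (auto simp: b_def algebra_simps)
    define B where "B = M * ?h m * ?w m + M * ?F m"
    have part: "(\<Sum>i=m..N. \<psi> i * ?w i) \<le> B" if "N \<ge> m" for N
    proof -
      have "(\<Sum>i=m..N. \<psi> i * ?w i) \<le> (\<Sum>i=m..N. b i * ?w i)"
      proof (rule sum_weighted_mono)
        fix n assume "n \<le> N"
        show "(\<Sum>i=m..n. \<psi> i) \<le> (\<Sum>i=m..n. b i)"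
        proof (cases "n \<ge> m")
          case True
          have "(\<Sum>i=m..n. \<psi> i) \<le> (\<Sum>i=1..n. \<psi> i)"
            using m2 pos by (intro sum_mono2) (auto simp: less_imp_le)
          also have "\<dots> \<le> M * ?h n" using bound[of n] True m2 by simp
          finally show ?thesis using sb[OF True] by simp
        qed auto
      next
        fix i assume "m \<le> i" "Suc i \<le> N"
        then show "?w (Suc i) \<le> ?w i"
          using real_log_weight_mono[of "real i" "real (Suc i)" k \<delta>] mpos[of i] assms wpos[of i] wpos[of "Suc i"]
          by (intro divide_left_mono) auto
      qed (use wpos in \<open>auto simp: less_imp_le\<close>)
      also have "\<dots> \<le> M * ?h m * ?w m + M * (?F m - ?F N)"
        using that
      proof (induction N rule: dec_induct)
        case base then show ?case by (simp add: b_def)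
      next
        case (step n)
        have "(?h (Suc n) - ?h n) * ?w (Suc n) \<le> ?F n - ?F (Suc n)"
          using sqrt_ln_increment_le[of "real n" "real (Suc n)" k \<delta>] mpos[of n] step assms
          by (simp add: diff_divide_distrib)
        then have "M * ((?h (Suc n) - ?h n) * ?w (Suc n)) \<le> M * (?F n - ?F (Suc n))"
          using M by (rule mult_left_mono)
        moreover have "b (Suc n) * ?w (Suc n) = M * ((?h (Suc n) - ?h n) * ?w (Suc n))"
          using step by (simp add: b_def)
        moreover have "(\<Sum>i=m..Suc n. b i * ?w i) = (\<Sum>i=m..n. b i * ?w i) + b (Suc n) * ?w (Suc n)"
          using step by simp
        moreover have "M * (?F m - ?F (Suc n)) = M * (?F m - ?F n) + M * (?F n - ?F (Suc n))"
          by (simp only: right_diff_distrib)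
        ultimately show ?case using step.IH by linarith
      qed
      also have "\<dots> \<le> B"
      proof -
        have "0 \<le> M * ?F N" using M assms by simp
        then show ?thesis by (simp only: B_def right_diff_distrib)
      qed
      finally show ?thesis .
    qed
    show ?thesis
    proof (rule nonneg_bdd_above_summable_on)
      show "0 \<le> \<psi> q / log_weight k \<delta> q" if "q \<in> log_domain k" for q
        using least[OF that] wpos[of q] pos[of q] m2 by (simp add: w less_imp_le)
      show "bdd_above (sum (\<lambda>q. \<psi> q / log_weight k \<delta> q) ` {F. F \<subseteq> log_domain k \<and> finite F})"
      proof (rule bdd_aboveI2)
        fix F assume "F \<in> {F. F \<subseteq> log_domain k \<and> finite F}"
        then have F: "F \<subseteq> log_domain k" "finite F" by auto
        define N where "N = Max (insert m F)"
        have N: "m \<le> N" "F \<subseteq> {m..N}" using F least by (auto simp: N_def)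
        have "sum (\<lambda>q. \<psi> q / log_weight k \<delta> q) F \<le> (\<Sum>i=m..N. \<psi> i / log_weight k \<delta> i)"
          using N pos m2 wpos by (intro sum_mono2) (auto simp: w less_imp_le)
        also have "\<dots> \<le> B" using part[OF N(1)] by (simp add: w)
        finally show "sum (\<lambda>q. \<psi> q / log_weight k \<delta> q) F \<le> B" .
      qed
    qed
  qed auto
  with div show False by (simp add: weighted_series_diverges_def)
qed

text \<open>Take the first \<open>R\<close> at which the ratio \<open>S(R) / sqrt (ln R)\<close> exceeds a constant larger than all its values
  up to \<open>K\<close>.\<close>
lemma exists_record:
  fixes S :: "nat \<Rightarrow> real"
  assumes unb: "\<And>M. \<exists>n\<ge>2. M * sqrt (ln (real n)) < S n"
  shows "\<exists>R\<ge>K. 2 \<le> R \<and> sqrt (ln (real R)) \<le> S R \<and>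
           (\<forall>n\<in>{2..R}. S n * sqrt (ln (real R)) \<le> S R * sqrt (ln (real n)))"
proof -
  let ?h = "\<lambda>n. sqrt (ln (real n))"
  have h: "?h n > 0" if "n \<ge> 2" for n using that by simp
  define M where "M = 1 + (\<Sum>n=2..K. \<bar>S n\<bar> / ?h n)"
  have M1: "M \<ge> 1" unfolding M_def by (auto intro!: sum_nonneg divide_nonneg_nonneg)
  define R where "R = (LEAST n. n \<ge> 2 \<and> M * ?h n < S n)"
  have "\<exists>n. n \<ge> 2 \<and> M * ?h n < S n" using unb by blast
  then have R: "R \<ge> 2" "M * ?h R < S R" unfolding R_def by (metis (mono_tags, lifting) LeastI_ex)+
  have small: "S n \<le> M * ?h n" if "2 \<le> n" "n < R" for n
    using not_less_Least[of n "\<lambda>n. n \<ge> 2 \<and> M * ?h n < S n"] that by (auto simp: R_def not_less)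
  have "R > K"
  proof (rule ccontr)
    assume "\<not> R > K"
    then have "\<bar>S R\<bar> / ?h R \<le> (\<Sum>n=2..K. \<bar>S n\<bar> / ?h n)" using R
      by (intro member_le_sum) auto
    then have "S R / ?h R \<le> M" using h[OF R(1)] unfolding M_def
      by (smt (verit) abs_ge_self divide_right_mono)
    then show False using R h[OF R(1)] by (simp add: pos_divide_le_eq)
  qed
  moreover have "?h R \<le> S R" using R(2) mult_right_mono[OF M1, of "?h R"] h[OF R(1)] by linarith
  moreover have "S n * ?h R \<le> S R * ?h n" if "n \<in> {2..R}" for n
  proof (cases "n = R")
    case False
    then have n: "2 \<le> n" "n < R" using that by auto
    have "S n * ?h R \<le> M * ?h n * ?h R" using small[OF n] h[OF R(1)] by (intro mult_right_mono) auto
    also have "\<dots> = (M * ?h R) * ?h n" by simp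
    also have "\<dots> \<le> S R * ?h n" using R(2) h[OF n(1)] by (intro mult_right_mono) auto
    finally show ?thesis .
  qed simp
  ultimately show ?thesis using R(1) by (intro exI[of _ R]) auto
qed

section \<open>Choice of the denominators\<close>

text \<open>The comparisons of growth used below, with \<open>L = ln R\<close>. The level \<open>z\<close> of the sieve is the integer part of
  \<open>exp (sqrt L / 8)\<close>, and \<open>exp (L/8)\<close> and \<open>exp (L/4)\<close> stand for \<open>R\<^bsup>1/8\<^esup>\<close> and \<open>R\<^bsup>1/4\<^esup>\<close>.\<close>
lemma record_scale_eventually:
  fixes c K :: real
  assumes "c > 0"
  shows "\<forall>\<^sub>F L in at_top. L \<ge> 256 \<and> K < exp (L / 8) \<and> K + 1 \<le> exp (sqrt L / 8) \<and>
           exp (sqrt L / 16) \<le> exp (sqrt L / 8) - 1 \<and> exp (L / 8) * (2 / c) * sqrt L \<le> exp (L / 4)"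
proof (intro eventually_conj)
  show "\<forall>\<^sub>F L :: real in at_top. L \<ge> 256" by (rule eventually_ge_at_top)
  show "\<forall>\<^sub>F L in at_top. K < exp (L / 8)" by real_asymp
  show "\<forall>\<^sub>F L in at_top. K + 1 \<le> exp (sqrt L / 8)" by real_asymp
  show "\<forall>\<^sub>F L :: real in at_top. exp (sqrt L / 16) \<le> exp (sqrt L / 8) - 1" by real_asymp
  show "\<forall>\<^sub>F L in at_top. exp (L / 8) * (2 / c) * sqrt L \<le> exp (L / 4)" using assms by real_asymp
qed

text \<open>The set \<open>Q\<close> consists of the rough numbers of the class in \<open>(R\<^bsup>1/8\<^esup>, R]\<close> for a record \<open>R\<close>. Above
  \<open>R\<^bsup>1/8\<^esup>\<close> the sieve of level \<open>z\<close> is effective, because \<open>8 (ln z)\<^sup>2 \<le> ln R / 8\<close>. The mass of \<open>Q\<close>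
  is at least a constant times \<open>S(R) / ln z\<close>, hence bounded below because
  \<open>S(R) \<ge> sqrt (ln R) \<ge> 8 ln z\<close>; and the gcd sum is at most a constant times \<open>S(R) / ln z\<close>.\<close>
lemma exists_quasi_independent_indices:
  fixes \<psi> :: "nat \<Rightarrow> real" and y z\<^sub>0 :: nat
  assumes y: "y \<ge> 1"
    and pos: "\<And>q. q \<ge> 1 \<Longrightarrow> 0 < \<psi> q"
    and mono: "\<And>q. q \<ge> 1 \<Longrightarrow> \<psi> (Suc q) \<le> \<psi> q"
    and unb: "\<And>M. \<exists>n\<ge>2. M * sqrt (ln (real n)) < (\<Sum>q=1..n. \<psi> q)"
  shows "\<exists>C>0. \<forall>K. \<exists>Q. finite Q \<and> Q \<subseteq> {q. K < q \<and> [q = z\<^sub>0] (mod y)} \<and> 0 < sum \<psi> Q \<and>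
           (\<Sum>r\<in>Q. \<Sum>q\<in>Q \<inter> {..r}. \<psi> r * (real (gcd q r) / real r)) \<le> C * (sum \<psi> Q)\<^sup>2"
proof -
  obtain c Z where c: "c > 0" and lower: "\<And>z x. z \<ge> Z \<Longrightarrow> x \<ge> 1 \<Longrightarrow> ln (real x) \<ge> 8 * ln (real z) ^ 2 \<Longrightarrow>
           c * (real x / ln (real z)) \<le> real (card {n\<in>rough y z \<inter> {..x}. [n = z\<^sub>0] (mod y)})"
    using rough_class_lower[OF y, of z\<^sub>0] by blast
  define D where "D = 40000 * real y ^ 3 * 257"
  have D: "D > 0" using y by (simp add: D_def)
  define S where "S n = (\<Sum>q=1..n. \<psi> q)" for n
  have main: "\<exists>Q. finite Q \<and> Q \<subseteq> {q. K < q \<and> [q = z\<^sub>0] (mod y)} \<and> 0 < sum \<psi> Q \<and>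
           (\<Sum>r\<in>Q. \<Sum>q\<in>Q \<inter> {..r}. \<psi> r * (real (gcd q r) / real r)) \<le> (2 * D / c\<^sup>2) * (sum \<psi> Q)\<^sup>2" for K
  proof -
    define K' where "K' = real (K + Z + y ^ 2 + 3)"
    obtain L\<^sub>0 where L0: "\<And>L. L \<ge> L\<^sub>0 \<Longrightarrow> L \<ge> 256 \<and> K' < exp (L / 8) \<and> K' + 1 \<le> exp (sqrt L / 8) \<and>
           exp (sqrt L / 16) \<le> exp (sqrt L / 8) - 1 \<and> exp (L / 8) * (2 / c) * sqrt L \<le> exp (L / 4)"
      using record_scale_eventually[OF c, of K'] unfolding eventually_at_top_linorder by blast
    obtain R where R: "R \<ge> nat \<lceil>exp L\<^sub>0\<rceil>" "2 \<le> R" "sqrt (ln (real R)) \<le> S R"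
        "\<And>n. n \<in> {2..R} \<Longrightarrow> S n * sqrt (ln (real R)) \<le> S R * sqrt (ln (real n))"
      using exists_record[of S "nat \<lceil>exp L\<^sub>0\<rceil>"] unb unfolding S_def by blast
    define L where "L = ln (real R)"
    have "exp L\<^sub>0 \<le> real R" using R(1) by linarith
    then have "L \<ge> L\<^sub>0" using R(2) by (simp add: L_def ln_ge_iff)
    note L = L0[OF this]
    define z where "z = nat \<lfloor>exp (sqrt L / 8)\<rfloor>"
    define l where "l = ln (real z)"
    have z1: "real z \<le> exp (sqrt L / 8)" unfolding z_def by (intro of_nat_floor) auto
    have z2: "exp (sqrt L / 8) - 1 < real z" unfolding z_def by linarith
    have zK: "K' \<le> real z" using z2 L by linarith
    then have zZ: "z \<ge> Z" "z \<ge> y ^ 2" "z \<ge> 3" unfolding K'_def by linarith+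
    have lu: "l \<le> sqrt L / 8" using z1 zZ ln_mono[of "real z" "exp (sqrt L / 8)"] by (simp add: l_def)
    have ll: "sqrt L / 16 \<le> l"
    proof -
      have "exp (sqrt L / 16) \<le> real z" using L z2 by linarith
      then show ?thesis using ln_mono[of "exp (sqrt L / 16)" "real z"] zZ by (simp add: l_def)
    qed
    have sL: "sqrt L \<ge> 16" using L real_sqrt_le_mono[of 256 L] by simp
    have l1: "l \<ge> 1" using ll sL by simp
    have lL: "8 * l\<^sup>2 \<le> L / 8" "L \<le> 256 * l\<^sup>2"
    proof -
      have "l\<^sup>2 \<le> (sqrt L / 8)\<^sup>2" using lu l1 by (intro power_mono) auto
      then show "8 * l\<^sup>2 \<le> L / 8" using L by (simp add: power_divide)
      have "(sqrt L / 16)\<^sup>2 \<le> l\<^sup>2" using ll L by (intro power_mono) auto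
      then show "L \<le> 256 * l\<^sup>2" using L by (simp add: power_divide)
    qed
    define V where "V = rough y z"
    define Q where "Q = {n\<in>V \<inter> {..R}. [n = z\<^sub>0] (mod y) \<and> exp (L / 8) < real n}"
    have finQ: "finite Q" by (simp add: Q_def)
    have Q1: "1 \<le> r" if "r \<in> Q" for r using that rough_pos[of r y z] by (simp add: Q_def V_def)
    have big: "ln (real x) \<ge> L / 8" "x \<ge> 1" if "exp (L / 8) \<le> real x" for x
    proof -
      have "real x > 0" using that exp_gt_zero[of "L/8"] by linarith
      then show "ln (real x) \<ge> L / 8" "x \<ge> 1" using ln_mono[of "exp (L / 8)" "real x"] that by auto
    qed
    have zx: "z\<^sup>2 \<le> x" if "exp (L / 8) \<le> real x" for x
    proof -
      have "2 * l \<le> 8 * l\<^sup>2" using l1 by (simp add: power2_eq_square)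
      also have "\<dots> \<le> ln (real x)" using lL big[OF that] by linarith
      finally have "ln (real z ^ 2) \<le> ln (real x)" using zZ by (simp add: l_def ln_realpow)
      then have "real z ^ 2 \<le> real x" using zZ big[OF that] by simp
      then show ?thesis by (metis of_nat_le_iff of_nat_power)
    qed
    \<comment> \<open>Above \<open>R\<^bsup>1/4\<^esup>\<close> removing the numbers up to \<open>R\<^bsup>1/8\<^esup>\<close> costs at most half of the count of rough
        numbers, and by the record property at least half of \<open>S(R)\<close> comes from this range.\<close>
    have mass: "c / (2 * l) * (S R / 2) \<le> sum \<psi> Q"
    proof -
      define a where "a n = (if exp (L / 4) < real n then c / (2 * l) else 0)" for n
      define b where "b n = (of_bool (n \<in> Q) :: real)" for n
      have ab: "(\<Sum>i=1..n. a i) \<le> (\<Sum>i=1..n. b i)" if "n \<le> R" for n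
      proof (cases "exp (L / 4) < real n")
        case True
        have e: "exp (L / 8) \<le> exp (L / 4)" using L by simp
        have "(\<Sum>i=1..n. a i) \<le> (\<Sum>i=1..n. c / (2 * l))"
          using c l1 by (intro sum_mono) (auto simp: a_def)
        also have "\<dots> = c * (real n / l) - c / 2 * (real n / l)" by (simp add: field_simps)
        also have "\<dots> \<le> c * (real n / l) - exp (L / 8)"
        proof -
          have "exp (L / 8) * l \<le> exp (L / 8) * sqrt L" using lu sL by (intro mult_left_mono) auto
          also have "\<dots> = c / 2 * (exp (L / 8) * (2 / c) * sqrt L)" using c by simp
          also have "\<dots> \<le> c / 2 * exp (L / 4)" using L c by (intro mult_left_mono) auto
          also have "\<dots> \<le> c / 2 * real n" using True c by (intro mult_left_mono) auto
          finally show ?thesis using l1 by (simp add: field_simps)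
        qed
        also have "\<dots> \<le> real (card {m\<in>V \<inter> {..n}. [m = z\<^sub>0] (mod y)}) - real (nat \<lfloor>exp (L / 8)\<rfloor>)"
        proof -
          have "exp (L / 8) \<le> real n" using True e by linarith
          then have "c * (real n / l) \<le> real (card {m\<in>V \<inter> {..n}. [m = z\<^sub>0] (mod y)})"
            using lower[OF zZ(1), of n] big[of n] lL by (simp add: l_def V_def)
          moreover have "real (nat \<lfloor>exp (L / 8)\<rfloor>) \<le> exp (L / 8)" by (intro of_nat_floor) auto
          ultimately show ?thesis by linarith
        qed
        also have "\<dots> \<le> real (card (Q \<inter> {1..n}))"
        proof -
          have "{m\<in>V \<inter> {..n}. [m = z\<^sub>0] (mod y)} \<subseteq> Q \<inter> {1..n} \<union> {1..nat \<lfloor>exp (L / 8)\<rfloor>}"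
          proof
            fix m assume m: "m \<in> {m\<in>V \<inter> {..n}. [m = z\<^sub>0] (mod y)}"
            then have "m \<ge> 1" using rough_pos[of m y z] by (simp add: V_def Suc_le_eq)
            with m that show "m \<in> Q \<inter> {1..n} \<union> {1..nat \<lfloor>exp (L / 8)\<rfloor>}"
              by (cases "exp (L / 8) < real m") (auto simp: Q_def le_nat_floor)
          qed
          then have "card {m\<in>V \<inter> {..n}. [m = z\<^sub>0] (mod y)} \<le> card (Q \<inter> {1..n} \<union> {1..nat \<lfloor>exp (L / 8)\<rfloor>})"
            by (intro card_mono) auto
          also have "\<dots> \<le> card (Q \<inter> {1..n}) + nat \<lfloor>exp (L / 8)\<rfloor>"
            by (rule order_trans[OF card_Un_le]) simp
          finally show ?thesis by linarith
        qed
        also have "\<dots> = (\<Sum>i=1..n. b i)" by (simp add: b_def Int_commute)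
        finally show ?thesis .
      next
        case False
        then have "(\<Sum>i=1..n. a i) = 0" by (intro sum.neutral) (auto simp: a_def)
        also have "0 \<le> (\<Sum>i=1..n. b i)" by (intro sum_nonneg) (auto simp: b_def)
        finally show ?thesis .
      qed
      define R2 where "R2 = nat \<lfloor>exp (L / 4)\<rfloor>"
      have R2: "real R2 \<le> exp (L / 4)" unfolding R2_def by (intro of_nat_floor) auto
      have e2: "2 \<le> exp (L / 4)" using exp_ge_add_one_self[of "L/4"] L by linarith
      then have R22: "2 \<le> R2" unfolding R2_def by (simp add: le_nat_floor)
      have R2R: "R2 \<le> R"
      proof -
        have "exp (L / 4) \<le> exp L" using L by simp
        also have "\<dots> = real R" using R(2) by (simp add: L_def)
        finally show ?thesis using R2 by linarith
      qed
      have "S R2 \<le> S R / 2"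
      proof -
        have "sqrt (ln (real R2)) \<le> sqrt (L / 4)" using R2 R22 ln_mono[of "real R2" "exp (L / 4)"] by simp
        also have "\<dots> = sqrt L / 2" by (simp add: real_sqrt_divide)
        finally have 1: "sqrt (ln (real R2)) \<le> sqrt L / 2" .
        have "S R2 * sqrt L \<le> S R * sqrt (ln (real R2))" using R(4)[of R2] R22 R2R by (simp add: L_def)
        also have "\<dots> \<le> S R * (sqrt L / 2)" using 1 R(3) sL by (intro mult_left_mono) (auto simp: L_def)
        finally have "S R2 * sqrt L \<le> (S R / 2) * sqrt L" by simp
        then show ?thesis by (rule mult_right_le_imp_le) (use sL in linarith)
      qed
      moreover have "S R = S R2 + (\<Sum>i\<in>{R2<..R}. \<psi> i)"
        unfolding S_def using R2R by (subst sum.union_disjoint [symmetric]) (auto intro!: sum.cong)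
      ultimately have "c / (2 * l) * (S R / 2) \<le> c / (2 * l) * (\<Sum>i\<in>{R2<..R}. \<psi> i)"
        using c l1 by (intro mult_left_mono) auto
      also have "\<dots> = (\<Sum>i\<in>{R2<..R}. a i * \<psi> i)"
        unfolding sum_distrib_left
      proof (intro sum.cong refl)
        fix i assume "i \<in> {R2<..R}"
        then have "exp (L / 4) < real i" unfolding R2_def by (simp, linarith)
        then show "c / (2 * l) * \<psi> i = a i * \<psi> i" by (simp add: a_def)
      qed
      also have "\<dots> \<le> (\<Sum>i=1..R. a i * \<psi> i)"
        using c l1 pos by (intro sum_mono2) (auto simp: a_def less_imp_le)
      also have "\<dots> \<le> (\<Sum>i=1..R. b i * \<psi> i)"
        by (rule sum_weighted_mono[OF ab]) (use pos mono in \<open>auto simp: less_imp_le\<close>)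
      also have "\<dots> = sum \<psi> Q"
      proof -
        have "sum \<psi> Q = (\<Sum>i\<in>Q. b i * \<psi> i)" by (intro sum.cong) (auto simp: b_def)
        also have "\<dots> = (\<Sum>i=1..R. b i * \<psi> i)"
          using Q1 by (intro sum.mono_neutral_left) (auto simp: Q_def b_def)
        finally show ?thesis by simp
      qed
      finally show ?thesis .
    qed
    \<comment> \<open>\<open>ln n \<le> L \<le> 256 l\<^sup>2\<close> makes both terms of the gcd estimate of order \<open>n / l\<close>, and summation by
        parts replaces \<open>n\<close> by \<open>S(R)\<close>.\<close>
    define t where "t r = (\<Sum>q\<in>Q \<inter> {..r}. real (gcd q r) / real r)" for r
    have gcds: "(\<Sum>r\<in>Q. \<psi> r * t r) \<le> D / l * S R"
    proof -
      define a where "a r = of_bool (r \<in> Q) * t r" for r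
      have a0: "a r \<ge> 0" for r by (simp add: a_def t_def sum_nonneg)
      have ab: "(\<Sum>i=1..n. a i) \<le> (\<Sum>i=1..n. D / l)" if "n \<le> R" for n
      proof (cases "exp (L / 8) < real n")
        case True
        then have n: "z\<^sup>2 \<le> n" "n \<ge> 1" using zx[of n] big[of n] by auto
        have "(\<Sum>i=1..n. a i) = (\<Sum>i\<in>Q \<inter> {..n}. t i)"
          using Q1 by (intro sum.mono_neutral_cong_right) (auto simp: a_def)
        also have "\<dots> \<le> (\<Sum>i\<in>Q \<inter> {..n}. \<Sum>q\<in>V \<inter> {..i}. real (gcd q i) / real i)"
          unfolding t_def by (intro sum_mono sum_mono2) (auto simp: Q_def)
        also have "\<dots> \<le> (\<Sum>i\<in>V \<inter> {..n}. \<Sum>q\<in>V \<inter> {..i}. real (gcd q i) / real i)"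
          by (intro sum_mono2 sum_nonneg) (auto simp: Q_def)
        also have "\<dots> \<le> 40000 * real y ^ 3 * real n * (1 / l + ln (real n) / l ^ 3)"
          unfolding V_def l_def using y zZ n by (intro sum_rough_gcd_upper) auto
        also have "\<dots> \<le> 40000 * real y ^ 3 * real n * (257 / l)"
        proof (intro mult_left_mono)
          have "ln (real n) \<le> L" using n that R(2) by (simp add: L_def)
          also have "\<dots> \<le> 256 * l\<^sup>2" by (rule lL)
          finally have "ln (real n) / l ^ 3 \<le> 256 * l\<^sup>2 / l ^ 3" using l1 by (intro divide_right_mono) auto
          also have "\<dots> = 256 / l" using l1 by (simp add: power2_eq_square power3_eq_cube)
          finally show "1 / l + ln (real n) / l ^ 3 \<le> 257 / l" by (simp add: add_divide_distrib [symmetric])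
        qed auto
        finally show ?thesis by (simp add: D_def field_simps)
      next
        case False
        have "(\<Sum>i=1..n. a i) = 0"
        proof (intro sum.neutral ballI)
          fix i assume "i \<in> {1..n}"
          with False have "i \<notin> Q" by (auto simp: Q_def)
          then show "a i = 0" by (simp add: a_def)
        qed
        then show ?thesis using D l1 by (simp add: sum_nonneg)
      qed
      have "(\<Sum>r\<in>Q. \<psi> r * t r) = (\<Sum>r=1..R. a r * \<psi> r)"
        using Q1 by (intro sum.mono_neutral_cong_left) (auto simp: Q_def a_def)
      also have "\<dots> \<le> (\<Sum>r=1..R. D / l * \<psi> r)"
        by (rule sum_weighted_mono[OF ab]) (use pos mono in \<open>auto simp: less_imp_le\<close>)
      also have "\<dots> = D / l * S R" by (simp add: S_def sum_distrib_left)
      finally show ?thesis .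
    qed
    have SR: "8 * l \<le> S R" using R(3) lu by (simp add: L_def)
    have "2 * c \<le> c / (2 * l) * (S R / 2)" using SR c l1 by (simp add: field_simps)
    with mass have mass2: "2 * c \<le> sum \<psi> Q" by linarith
    have "D / l * S R = (2 * D / c\<^sup>2) * ((2 * c) * (c / (2 * l) * (S R / 2)))"
      using c by (simp add: power2_eq_square)
    also have "\<dots> \<le> (2 * D / c\<^sup>2) * (sum \<psi> Q * sum \<psi> Q)"
      using mass mass2 c D l1 SR by (intro mult_left_mono mult_mono) auto
    finally have "(\<Sum>r\<in>Q. \<psi> r * t r) \<le> (2 * D / c\<^sup>2) * (sum \<psi> Q)\<^sup>2"
      using gcds by (simp add: power2_eq_square)
    moreover have "(\<Sum>r\<in>Q. \<Sum>q\<in>Q \<inter> {..r}. \<psi> r * (real (gcd q r) / real r)) = (\<Sum>r\<in>Q. \<psi> r * t r)"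
      by (simp add: t_def sum_distrib_left)
    moreover have "Q \<subseteq> {q. K < q \<and> [q = z\<^sub>0] (mod y)}"
    proof
      fix q assume q: "q \<in> Q"
      then have "K' < real q" using L by (simp add: Q_def)
      then have "K < q" unfolding K'_def by linarith
      with q show "q \<in> {q. K < q \<and> [q = z\<^sub>0] (mod y)}" by (simp add: Q_def)
    qed
    ultimately show ?thesis using finQ mass2 c by (intro exI[of _ Q]) auto
  qed
  have "2 * D / c\<^sup>2 > 0" using D c by simp
  with main show ?thesis by blast
qed

section \<open>Arcs around moving targets\<close>

lemma card_int_open_interval_le:
  fixes x y :: real
  assumes "x \<le> y"
  shows "finite {n::int. x < of_int n \<and> of_int n < y}"
    and "real (card {n::int. x < of_int n \<and> of_int n < y}) \<le> y - x + 1"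
proof -
  have eq: "{n::int. x < of_int n \<and> of_int n < y} = {\<lfloor>x\<rfloor> + 1..\<lceil>y\<rceil> - 1}"
    by (auto simp: floor_less_iff less_ceiling_iff) linarith+
  then show "finite {n::int. x < of_int n \<and> of_int n < y}" by simp
  have "real (card {n::int. x < of_int n \<and> of_int n < y}) = real (nat (\<lceil>y\<rceil> - 1 - \<lfloor>x\<rfloor>))"
    unfolding eq by simp
  also have "\<dots> \<le> y - x + 1" using assms by linarith
  finally show "real (card {n::int. x < of_int n \<and> of_int n < y}) \<le> y - x + 1" .
qed

lemma card_int_closed_interval_ge:
  fixes x y :: real
  shows "finite {n::int. x \<le> of_int n \<and> of_int n \<le> y}"
    and "y - x - 1 \<le> real (card {n::int. x \<le> of_int n \<and> of_int n \<le> y})"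
proof -
  have eq: "{n::int. x \<le> of_int n \<and> of_int n \<le> y} = {\<lceil>x\<rceil>..\<lfloor>y\<rfloor>}"
    by (auto simp: ceiling_le_iff le_floor_iff)
  then show "finite {n::int. x \<le> of_int n \<and> of_int n \<le> y}" by simp
  show "y - x - 1 \<le> real (card {n::int. x \<le> of_int n \<and> of_int n \<le> y})"
    unfolding eq by simp linarith
qed

text \<open>The values of \<open>a r - b q\<close> are multiples of \<open>g = gcd q r\<close> in an interval of length \<open>2D\<close>, at most
  \<open>2D/g + 1\<close> of them. Each value determines \<open>a\<close> modulo \<open>q/g\<close>, hence leaves at most \<open>g\<close> choices in a window of
  length \<open>q\<close>, and then \<open>b\<close> is determined.\<close>
lemma card_linear_form_le:
  fixes q r :: nat and u s D :: real and T :: "(int \<times> int) set"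
  assumes "q \<ge> 1" "r \<ge> 1" "D \<ge> 0"
    and T: "\<And>a b. (a, b) \<in> T \<Longrightarrow> u \<le> of_int a \<and> of_int a < u + real q \<and>
              \<bar>of_int (a * int r - b * int q) + s\<bar> < D"
  shows "finite T" "real (card T) \<le> 2 * D + real (gcd q r)"
proof -
  define g where "g = gcd q r"
  have g: "g \<ge> 1" using assms by (simp add: g_def Suc_le_eq)
  obtain q' r' where q': "q = g * q'" and r': "r = g * r'" and cop: "coprime q' r'"
    using gcd_coprime_exists[of q r] g by (metis g_def mult.commute not_one_le_zero)
  have q'0: "q' > 0" using q' assms by (cases q') auto
  define N where "N = {n::int. (- s - D) / real g < of_int n \<and> of_int n < (- s + D) / real g}"
  \<comment> \<open>the value of the form divided by \<open>g\<close>, and the block of length \<open>q/g\<close> of the window that contains \<open>a\<close>\<close>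
  define \<Phi> where "\<Phi> = (\<lambda>(a::int, b::int). (a * int r' - b * int q', (a - \<lceil>u\<rceil>) div int q'))"
  have le: "(- s - D) / real g \<le> (- s + D) / real g" using assms by (intro divide_right_mono) auto
  have N: "finite N" "real (card N) \<le> 2 * D / real g + 1"
    using card_int_open_interval_le[OF le] unfolding N_def by (auto simp: diff_divide_distrib [symmetric])
  have img: "\<Phi> ` T \<subseteq> N \<times> {0..<int g}"
  proof clarify
    fix a b n k assume ab: "(a, b) \<in> T" and nk: "(n, k) = \<Phi> (a, b)"
    have n: "n = a * int r' - b * int q'" and k: "k = (a - \<lceil>u\<rceil>) div int q'" using nk by (auto simp: \<Phi>_def)
    have "a * int r - b * int q = int g * n" by (simp add: q' r' n algebra_simps)
    then have "\<bar>real g * of_int n + s\<bar> < D" using T[OF ab] by (metis of_int_mult of_int_of_nat_eq)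
    then have "n \<in> N" using g by (auto simp: N_def abs_less_iff field_simps)
    have "0 \<le> a - \<lceil>u\<rceil>" "a - \<lceil>u\<rceil> < int q" using T[OF ab] by linarith+
    then have "0 \<le> k" using q'0 unfolding k by (simp add: pos_imp_zdiv_nonneg_iff)
    have "k * int q' \<le> a - \<lceil>u\<rceil>" unfolding k minus_mod_eq_div_mult [symmetric] using q'0 by simp
    also have "\<dots> < int g * int q'" using \<open>a - \<lceil>u\<rceil> < int q\<close> by (simp add: q')
    finally have "k < int g" using q'0 by simp
    note \<open>n \<in> N\<close> \<open>0 \<le> k\<close> \<open>k < int g\<close>
    then show "n \<in> N \<and> k \<in> {0..<int g}" by simp
  qed
  have inj: "inj_on \<Phi> T"
  proof (rule inj_onI, clarify)
    fix a b a' b' assume "(a, b) \<in> T" "(a', b') \<in> T" and eq: "\<Phi> (a, b) = \<Phi> (a', b')"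
    have 1: "a * int r' - b * int q' = a' * int r' - b' * int q'"
      and 2: "(a - \<lceil>u\<rceil>) div int q' = (a' - \<lceil>u\<rceil>) div int q'" using eq by (auto simp: \<Phi>_def)
    from 1 have 3: "(a - a') * int r' = (b - b') * int q'" by (simp add: algebra_simps)
    then have "int q' dvd (a - a') * int r'" by simp
    then have "int q' dvd a - a'" using cop by (simp add: coprime_dvd_mult_left_iff)
    then have "int q' dvd (a - \<lceil>u\<rceil>) - (a' - \<lceil>u\<rceil>)" by simp
    then have "(a - \<lceil>u\<rceil>) mod int q' = (a' - \<lceil>u\<rceil>) mod int q'" by (simp only: mod_eq_dvd_iff)
    with 2 have "a - \<lceil>u\<rceil> = a' - \<lceil>u\<rceil>" by (metis div_mult_mod_eq)
    then have "a = a'" by simp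
    with 3 q'0 show "a = a' \<and> b = b'" by simp
  qed
  have fin: "finite (N \<times> {0..<int g})" using N by simp
  show "finite T" using inj_on_finite[OF inj img fin] .
  have "card T \<le> card (N \<times> {0..<int g})" by (rule card_inj_on_le[OF inj img fin])
  also have "\<dots> = card N * g" by (simp add: card_cartesian_product)
  finally have "real (card T) \<le> real (card N * g)" by (rule of_nat_mono)
  also have "\<dots> = real (card N) * real g" by simp
  also have "\<dots> \<le> (2 * D / real g + 1) * real g" using N by (intro mult_right_mono) auto
  also have "\<dots> = 2 * D + real g" using g by (simp add: field_simps)
  finally show "real (card T) \<le> 2 * D + real (gcd q r)" by (simp add: g_def)
qed

lemma measure_UN_disjoint_lmeasurable:
  fixes S :: "'i \<Rightarrow> real set"
  assumes "finite I" "disjoint_family_on S I" "\<And>i. i \<in> I \<Longrightarrow> S i \<in> lmeasurable"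
  shows "measure lebesgue (\<Union>i\<in>I. S i) = (\<Sum>i\<in>I. measure lebesgue (S i))"
proof (rule measure_finite_Union)
  show "S ` I \<subseteq> sets lebesgue" using assms(3) fmeasurableD by blast
  show "emeasure lebesgue (S i) \<noteq> \<infinity>" if "i \<in> I" for i
    unfolding infinity_ennreal_def using assms(3)[OF that] by (rule fmeasurableD2)
qed (use assms in auto)

text \<open>Cauchy-Schwarz for \<open>f = \<Sum>1\<^bsub>A\<^sub>q\<^esub>\<close> on \<open>D\<close> in its linearised form
  \<open>2 f 1\<^sub>D \<le> f\<^sup>2 / lam + lam 1\<^sub>D\<close>, which integrates term by term.\<close>
lemma sum_measure_Int_le_second_moment:
  fixes A :: "nat \<Rightarrow> real set" and lam :: real
  assumes Q: "finite Q" and A: "\<And>q. q \<in> Q \<Longrightarrow> A q \<in> lmeasurable" and D: "D \<in> lmeasurable" and lam: "lam > 0"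
  shows "(\<Sum>q\<in>Q. measure lebesgue (A q \<inter> D))
       \<le> ((\<Sum>q\<in>Q. \<Sum>r\<in>Q. measure lebesgue (A q \<inter> A r)) / lam + lam * measure lebesgue D) / 2"
proof -
  have int: "integrable lebesgue (indicator S :: real \<Rightarrow> real)" if "S \<in> lmeasurable" for S
    using that by (intro integrable_real_indicator) (auto simp: fmeasurable_def)
  have AD: "A q \<inter> D \<in> lmeasurable" if "q \<in> Q" for q using A[OF that] D by (rule fmeasurable.Int)
  have AA: "A q \<inter> A r \<in> lmeasurable" if "q \<in> Q" "r \<in> Q" for q r using A that by (intro fmeasurable.Int) auto
  define F G :: "real \<Rightarrow> real" where "F = (\<lambda>x. \<Sum>q\<in>Q. indicator (A q \<inter> D) x)"
    and "G = (\<lambda>x. ((\<Sum>q\<in>Q. \<Sum>r\<in>Q. indicator (A q \<inter> A r) x) / lam + lam * indicator D x) / 2)"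
  have iF: "integrable lebesgue F" unfolding F_def by (intro Bochner_Integration.integrable_sum int AD)
  have iG: "integrable lebesgue G" unfolding G_def
    by (intro integrable_divide_zero Bochner_Integration.integrable_add integrable_mult_right
        Bochner_Integration.integrable_sum int AA D impI)
  have "integral\<^sup>L lebesgue F \<le> integral\<^sup>L lebesgue G"
  proof (rule integral_mono[OF iF iG])
    fix x :: real
    define f :: real where "f = (\<Sum>q\<in>Q. indicator (A q) x)"
    define d :: real where "d = indicator D x"
    have F: "F x = f * d" by (simp add: F_def f_def d_def sum_distrib_right indicator_inter_arith)
    have G: "G x = (f * f / lam + lam * d) / 2"
      by (simp add: G_def f_def d_def sum_product indicator_inter_arith)
    have "d * d = d" by (simp add: d_def indicator_def)
    have "0 \<le> (f - lam * d)\<^sup>2 / lam" using lam by simp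
    also have "(f - lam * d)\<^sup>2 / lam = f * f / lam - 2 * (f * d) + lam * (d * d)"
      using lam by (simp add: power2_eq_square field_simps)
    finally show "F x \<le> G x" using \<open>d * d = d\<close> by (simp add: F G)
  qed
  also have "integral\<^sup>L lebesgue F = (\<Sum>q\<in>Q. measure lebesgue (A q \<inter> D))"
    unfolding F_def using AD by (subst Bochner_Integration.integral_sum) (auto intro: int)
  also have "integral\<^sup>L lebesgue G = ((\<Sum>q\<in>Q. \<Sum>r\<in>Q. measure lebesgue (A q \<inter> A r)) / lam + lam * measure lebesgue D) / 2"
  proof -
    have i1: "integrable lebesgue (\<lambda>x. \<Sum>q\<in>Q. \<Sum>r\<in>Q. indicator (A q \<inter> A r) x :: real)"
      by (intro Bochner_Integration.integrable_sum int AA)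
    have "integral\<^sup>L lebesgue (\<lambda>x. \<Sum>q\<in>Q. \<Sum>r\<in>Q. indicator (A q \<inter> A r) x :: real)
        = (\<Sum>q\<in>Q. \<Sum>r\<in>Q. measure lebesgue (A q \<inter> A r))"
      by (subst Bochner_Integration.integral_sum, intro Bochner_Integration.integrable_sum int AA, assumption+,
          intro sum.cong refl, subst Bochner_Integration.integral_sum) (auto intro: int AA)
    then show ?thesis unfolding G_def using i1 int[OF D]
      by (simp add: Bochner_Integration.integral_add)
  qed
  finally show ?thesis .
qed

locale moving_targets =
  fixes \<psi> \<gamma> :: "nat \<Rightarrow> real" and \<epsilon> :: "int \<Rightarrow> nat \<Rightarrow> real" and C\<^sub>0 :: real
  assumes psi_pos: "\<And>q. q \<ge> 1 \<Longrightarrow> 0 < \<psi> q"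
    and psi_antimono: "\<And>q r. 1 \<le> q \<Longrightarrow> q \<le> r \<Longrightarrow> \<psi> r \<le> \<psi> q"
    and C0_pos: "0 < C\<^sub>0"
    and eps_bound: "\<And>q a. q \<ge> 1 \<Longrightarrow> \<bar>\<epsilon> a q\<bar> \<le> C\<^sub>0 * \<psi> q"
begin

text \<open>Every point of an arc with numerator \<open>a\<close> satisfies \<open>|q x - (a + \<gamma>\<^sub>q)| < margin\<close>, uniformly in \<open>q\<close>. Only
  numerators divisible by \<open>spacing\<close> are kept, which makes the arcs disjoint even if \<open>\<psi>\<close> does not tend
  to \<open>0\<close>.\<close>
definition margin :: real where "margin = (1 + C\<^sub>0) * \<psi> 1"

definition spacing :: nat where "spacing = nat \<lceil>2 * margin\<rceil>"

definition centre :: "nat \<Rightarrow> int \<Rightarrow> real" where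
  "centre q a = (of_int a + (\<gamma> q + \<epsilon> a q)) / real q"

text \<open>The two inequalities keep the arcs inside \<open>(0,1)\<close>, so that no reduction modulo \<open>1\<close> is needed, and confine
  \<open>a\<close> to a window of length less than \<open>q\<close>.\<close>
definition numerators :: "nat \<Rightarrow> int set" where
  "numerators q = {a. int spacing dvd a \<and> margin \<le> of_int a + \<gamma> q \<and> of_int a + \<gamma> q \<le> real q - margin}"

definition arcs :: "nat \<Rightarrow> real set" where
  "arcs q = (\<Union>a\<in>numerators q. ball (centre q a) (\<psi> q / real q))"

lemma margin_pos: "0 < margin"
  using C0_pos psi_pos[of 1] by (simp add: margin_def)

lemma spacing: "2 * margin \<le> real spacing" "0 < spacing"
  using margin_pos unfolding spacing_def by linarith+

lemma psi_margin: "q \<ge> 1 \<Longrightarrow> (1 + C\<^sub>0) * \<psi> q \<le> margin"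
  unfolding margin_def using psi_antimono[of 1 q] C0_pos by (intro mult_left_mono) auto

lemma ball_centre_bounds:
  assumes q: "q \<ge> 1" and x: "x \<in> ball (centre q a) (\<psi> q / real q)"
  shows "\<bar>real q * x - (of_int a + \<gamma> q)\<bar> < (1 + C\<^sub>0) * \<psi> q"
proof -
  have "\<bar>centre q a - x\<bar> < \<psi> q / real q" using x by (simp add: dist_real_def)
  then have "\<bar>centre q a - x\<bar> * real q < \<psi> q" using q by (simp add: pos_less_divide_eq)
  also have "\<bar>centre q a - x\<bar> * real q = \<bar>(centre q a - x) * real q\<bar>" by (simp add: abs_mult)
  also have "(centre q a - x) * real q = of_int a + (\<gamma> q + \<epsilon> a q) - real q * x"
  proof -
    have "centre q a * real q = of_int a + (\<gamma> q + \<epsilon> a q)" using q by (simp add: centre_def)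
    then show ?thesis by (metis left_diff_distrib mult.commute)
  qed
  finally show ?thesis using eps_bound[OF q, of a] by (simp add: algebra_simps)
qed

lemma arcs_subset: "q \<ge> 1 \<Longrightarrow> arcs q \<subseteq> {0<..<1}"
proof
  fix x assume q: "q \<ge> 1" and "x \<in> arcs q"
  then obtain a where a: "a \<in> numerators q" and x: "x \<in> ball (centre q a) (\<psi> q / real q)"
    by (auto simp: arcs_def)
  have "\<bar>real q * x - (of_int a + \<gamma> q)\<bar> < margin"
    using ball_centre_bounds[OF q x] psi_margin[OF q] by linarith
  with a have "0 < real q * x" "real q * x < real q * 1" by (auto simp: numerators_def)
  then show "x \<in> {0<..<1}" using q by (simp add: zero_less_mult_iff)
qed

lemma open_arcs: "open (arcs q)"
  by (auto simp: arcs_def)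

lemma arcs_lmeasurable: "q \<ge> 1 \<Longrightarrow> arcs q \<in> lmeasurable"
  by (intro lmeasurable_open open_arcs) (metis arcs_subset bounded_box box_real(1) bounded_subset)

text \<open>If the arcs belonging to \<open>a\<close> and \<open>b\<close> meet, then \<open>a r - b q\<close> lies within
  \<open>D = 2 (1 + C\<^sub>0) r \<psi>(q)\<close> of a number depending only on \<open>q\<close> and \<open>r\<close>; the perturbations \<open>\<epsilon>\<close> only enlarge
  the constant. Count the pairs and bound each intersection by the length of the arc for \<open>r\<close>.\<close>
lemma measure_arcs_Int_le:
  assumes "1 \<le> q" "q \<le> r"
  shows "measure lebesgue (arcs q \<inter> arcs r)
       \<le> 8 * (1 + C\<^sub>0) * (\<psi> q * \<psi> r) + 2 * (\<psi> r * (real (gcd q r) / real r))"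
proof -
  have r: "r \<ge> 1" using assms by simp
  define D where "D = 2 * (1 + C\<^sub>0) * (real r * \<psi> q)"
  have pq: "\<psi> q > 0" "\<psi> r > 0" "\<psi> r \<le> \<psi> q" using psi_pos assms r psi_antimono by auto
  have D0: "D \<ge> 0" using pq C0_pos by (simp add: D_def)
  define T where "T = {(a, b). a \<in> numerators q \<and> b \<in> numerators r \<and>
      ball (centre q a) (\<psi> q / real q) \<inter> ball (centre r b) (\<psi> r / real r) \<noteq> {}}"
  have T: "- \<gamma> q \<le> of_int a \<and> of_int a < - \<gamma> q + real q \<and>
      \<bar>of_int (a * int r - b * int q) + (real r * \<gamma> q - real q * \<gamma> r)\<bar> < D" if ab: "(a, b) \<in> T" for a b
  proof -
    obtain x where x: "x \<in> ball (centre q a) (\<psi> q / real q)" "x \<in> ball (centre r b) (\<psi> r / real r)"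
      using ab by (auto simp: T_def)
    have "real r * \<bar>real q * x - (of_int a + \<gamma> q)\<bar> < real r * ((1 + C\<^sub>0) * \<psi> q)"
      using ball_centre_bounds[OF assms(1) x(1)] r by (intro mult_strict_left_mono) auto
    then have 1: "\<bar>real r * (real q * x) - real r * (of_int a + \<gamma> q)\<bar> < (1 + C\<^sub>0) * (real r * \<psi> q)"
      using abs_mult[of "real r" "real q * x - (of_int a + \<gamma> q)"] by (simp add: right_diff_distrib mult_ac)
    have "real q * \<bar>real r * x - (of_int b + \<gamma> r)\<bar> < real q * ((1 + C\<^sub>0) * \<psi> r)"
      using ball_centre_bounds[OF r x(2)] assms by (intro mult_strict_left_mono) auto
    also have "\<dots> \<le> real r * ((1 + C\<^sub>0) * \<psi> q)"
      using assms pq C0_pos by (intro mult_mono) auto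
    finally have 2: "\<bar>real q * (real r * x) - real q * (of_int b + \<gamma> r)\<bar> < (1 + C\<^sub>0) * (real r * \<psi> q)"
      using abs_mult[of "real q" "real r * x - (of_int b + \<gamma> r)"] by (simp add: right_diff_distrib mult_ac)
    have 3: "real q * (real r * x) = real r * (real q * x)" by simp
    have "of_int (a * int r - b * int q) + (real r * \<gamma> q - real q * \<gamma> r)
        = real r * (of_int a + \<gamma> q) - real q * (of_int b + \<gamma> r)" by (simp add: algebra_simps)
    then have "\<bar>of_int (a * int r - b * int q) + (real r * \<gamma> q - real q * \<gamma> r)\<bar> < D"
      using 1 2 unfolding 3 D_def by linarith
    then show ?thesis using ab margin_pos by (auto simp: T_def numerators_def)
  qed
  note card = card_linear_form_le[OF assms(1) r D0 T]
  have "measure lebesgue (arcs q \<inter> arcs r) \<le> measure lebesgue (\<Union>p\<in>T. ball (centre r (snd p)) (\<psi> r / real r))"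
  proof (rule measure_mono_fmeasurable)
    show "arcs q \<inter> arcs r \<subseteq> (\<Union>p\<in>T. ball (centre r (snd p)) (\<psi> r / real r))"
      by (force simp: arcs_def T_def)
    show "arcs q \<inter> arcs r \<in> sets lebesgue"
      using arcs_lmeasurable[OF assms(1)] arcs_lmeasurable[OF r] by auto
    show "(\<Union>p\<in>T. ball (centre r (snd p)) (\<psi> r / real r)) \<in> lmeasurable"
      using card(1) by (intro fmeasurable.finite_UN) auto
  qed
  also have "\<dots> \<le> (\<Sum>p\<in>T. measure lebesgue (ball (centre r (snd p)) (\<psi> r / real r)))"
    using card(1) by (intro measure_UNION_le) auto
  also have "\<dots> = real (card T) * (2 * \<psi> r / real r)"
    using pq by (simp add: ball_eq_greaterThanLessThan)
  also have "\<dots> \<le> (2 * D + real (gcd q r)) * (2 * \<psi> r / real r)"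
    using pq by (intro mult_right_mono card(2)) auto
  also have "\<dots> = 8 * (1 + C\<^sub>0) * (\<psi> q * \<psi> r) + 2 * (\<psi> r * (real (gcd q r) / real r))"
    using r by (simp add: D_def field_simps)
  finally show ?thesis .
qed

text \<open>A grid cell of length \<open>1/N\<close> contains about \<open>q / (N spacing)\<close> arcs, and the loss at its boundary is at most half
  of them once \<open>q\<close> is large in terms of \<open>N\<close>.\<close>
lemma measure_arcs_cell_ge:
  assumes "N \<ge> 1"
  shows "\<exists>q\<^sub>0. \<forall>q\<ge>q\<^sub>0. \<forall>i<N. \<psi> q / (real N * real spacing)
           \<le> measure lebesgue (arcs q \<inter> {real i / real N..<real (i + 1) / real N})"
proof (intro exI allI impI)
  fix q i :: nat
  let ?M = "real spacing"
  assume q0: "q \<ge> max 1 (nat \<lceil>2 * real N * (2 * margin + ?M)\<rceil>)" and i: "i < N"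
  then have q: "q \<ge> 1" and "2 * real N * (2 * margin + ?M) \<le> real q" by linarith+
  then have qN: "2 * margin + ?M \<le> real q / (2 * real N)" using assms by (simp add: field_simps)
  have M: "?M > 0" using spacing by simp
  define lo hi where "lo = real i / real N * real q + margin - \<gamma> q"
    and "hi = real (i + 1) / real N * real q - margin - \<gamma> q"
  define J where "J = {k::int. lo / ?M \<le> of_int k \<and> of_int k \<le> hi / ?M}"
  define cen where "cen k = centre q (int spacing * k)" for k
  have J: "lo \<le> of_int (int spacing * k) \<and> of_int (int spacing * k) \<le> hi" if "k \<in> J" for k
    using that M by (simp add: J_def field_simps)
  have finJ: "finite J" unfolding J_def by (rule card_int_closed_interval_ge)
  have cardJ: "real q / (2 * real N * ?M) \<le> real (card J)"
  proof -
    have "hi - lo = real q / real N - 2 * margin"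
      using assms by (simp add: hi_def lo_def field_simps)
    then have "real q / (2 * real N) \<le> hi - lo - ?M" using qN by (simp add: field_simps)
    then have "real q / (2 * real N) / ?M \<le> (hi - lo - ?M) / ?M" using M by (intro divide_right_mono) auto
    also have "\<dots> = hi / ?M - lo / ?M - 1" using M by (simp add: diff_divide_distrib)
    also have "\<dots> \<le> real (card J)" unfolding J_def by (rule card_int_closed_interval_ge)
    finally show ?thesis by simp
  qed
  have num: "int spacing * k \<in> numerators q" if "k \<in> J" for k
  proof -
    have "0 \<le> real i / real N * real q" by simp
    moreover have "real (i + 1) / real N * real q \<le> 1 * real q"
      using i by (intro mult_right_mono) auto
    ultimately have "margin \<le> of_int (int spacing * k) + \<gamma> q" "of_int (int spacing * k) + \<gamma> q \<le> real q - margin"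
      using J[OF that] unfolding lo_def hi_def by linarith+
    then show ?thesis by (simp add: numerators_def)
  qed
  have cell: "ball (cen k) (\<psi> q / real q) \<subseteq> {real i / real N..<real (i + 1) / real N}" if "k \<in> J" for k
  proof
    fix x assume "x \<in> ball (cen k) (\<psi> q / real q)"
    then have "\<bar>real q * x - (of_int (int spacing * k) + \<gamma> q)\<bar> < margin"
      using ball_centre_bounds[OF q] psi_margin[OF q] unfolding cen_def by (meson less_le_trans)
    then have "real i / real N * real q \<le> x * real q" "x * real q < real (i + 1) / real N * real q"
      using J[OF that] unfolding lo_def hi_def by (auto simp: mult.commute)
    then have "real i / real N \<le> x" "x < real (i + 1) / real N"
      using q by (simp_all only: mult_le_cancel_right mult_less_cancel_right)
    then show "x \<in> {real i / real N..<real (i + 1) / real N}" by simp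
  qed
  have disj: "disjoint_family_on (\<lambda>k. ball (cen k) (\<psi> q / real q)) J"
    unfolding disjoint_family_on_def
  proof (intro ballI impI, rule ccontr)
    fix k k' assume k: "k \<in> J" "k' \<in> J" "k \<noteq> k'"
    assume "ball (cen k) (\<psi> q / real q) \<inter> ball (cen k') (\<psi> q / real q) \<noteq> {}"
    then obtain x where "x \<in> ball (cen k) (\<psi> q / real q)" "x \<in> ball (cen k') (\<psi> q / real q)" by blast
    then have "\<bar>real q * x - (of_int (int spacing * k) + \<gamma> q)\<bar> < margin"
       "\<bar>real q * x - (of_int (int spacing * k') + \<gamma> q)\<bar> < margin"
      using ball_centre_bounds[OF q] psi_margin[OF q] unfolding cen_def by (meson less_le_trans)+
    then have "\<bar>of_int (int spacing * k) - of_int (int spacing * k')\<bar> < ?M"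
      using spacing(1) by linarith
    then have "?M * \<bar>of_int (k - k')\<bar> < ?M * 1"
      using abs_mult[of ?M "of_int (k - k')"] by (simp add: right_diff_distrib)
    then have "\<bar>of_int (k - k') :: real\<bar> < 1" using M by simp
    then have "\<bar>k - k'\<bar> < 1" by linarith
    with k show False by simp
  qed
  have "\<psi> q / (real N * ?M) = (real q / (2 * real N * ?M)) * (2 * \<psi> q / real q)"
    using q by simp
  also have "\<dots> \<le> real (card J) * (2 * \<psi> q / real q)"
    using psi_pos[OF q] by (intro mult_right_mono cardJ) auto
  also have "\<dots> = (\<Sum>k\<in>J. measure lebesgue (ball (cen k) (\<psi> q / real q)))"
    using psi_pos[OF q] by (simp add: ball_eq_greaterThanLessThan)
  also have "\<dots> = measure lebesgue (\<Union>k\<in>J. ball (cen k) (\<psi> q / real q))"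
    using finJ disj by (intro measure_UN_disjoint_lmeasurable [symmetric]) auto
  also have "\<dots> \<le> measure lebesgue (arcs q \<inter> {real i / real N..<real (i + 1) / real N})"
  proof (rule measure_mono_fmeasurable)
    show "(\<Union>k\<in>J. ball (cen k) (\<psi> q / real q)) \<subseteq> arcs q \<inter> {real i / real N..<real (i + 1) / real N}"
      using cell num by (fastforce simp: arcs_def cen_def)
    show "arcs q \<inter> {real i / real N..<real (i + 1) / real N} \<in> lmeasurable"
      using arcs_lmeasurable[OF q] by (intro fmeasurable_Int_fmeasurable) auto
  qed auto
  finally show "\<psi> q / (real N * ?M) \<le> measure lebesgue (arcs q \<inter> {real i / real N..<real (i + 1) / real N})" .
qed

end

section \<open>From the second moment to full measure\<close>

context moving_targets
begin

lemma sum_measure_arcs_Int_le: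
  assumes Q: "finite Q" "\<And>q. q \<in> Q \<Longrightarrow> q \<ge> 1"
    and C: "(\<Sum>r\<in>Q. \<Sum>q\<in>Q \<inter> {..r}. \<psi> r * (real (gcd q r) / real r)) \<le> C * (sum \<psi> Q)\<^sup>2"
  shows "(\<Sum>q\<in>Q. \<Sum>r\<in>Q. measure lebesgue (arcs q \<inter> arcs r)) \<le> (16 * (1 + C\<^sub>0) + 4 * C) * (sum \<psi> Q)\<^sup>2"
proof -
  define m where "m q r = measure lebesgue (arcs q \<inter> arcs r)" for q r
  have m0: "m q r \<ge> 0" for q r by (simp add: m_def)
  have sym: "m q r = m r q" for q r by (simp add: m_def Int_commute)
  have split: "(\<Sum>q\<in>Q. m q r) \<le> (\<Sum>q\<in>Q \<inter> {..r}. m q r) + (\<Sum>q\<in>Q \<inter> {r..}. m q r)" for r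
  proof -
    have "(\<Sum>q\<in>Q. m q r) = (\<Sum>q\<in>Q \<inter> {..r} \<union> Q \<inter> {r<..}. m q r)" by (rule sum.cong) auto
    also have "\<dots> = (\<Sum>q\<in>Q \<inter> {..r}. m q r) + (\<Sum>q\<in>Q \<inter> {r<..}. m q r)"
      using Q by (intro sum.union_disjoint) auto
    also have "(\<Sum>q\<in>Q \<inter> {r<..}. m q r) \<le> (\<Sum>q\<in>Q \<inter> {r..}. m q r)"
      using Q m0 by (intro sum_mono2) auto
    finally show ?thesis by simp
  qed
  have swap: "(\<Sum>r\<in>Q. \<Sum>q\<in>Q \<inter> {r..}. m q r) = (\<Sum>r\<in>Q. \<Sum>q\<in>Q \<inter> {..r}. m q r)"
  proof -
    have "(\<Sum>r\<in>Q. \<Sum>q\<in>Q \<inter> {r..}. m q r) = (\<Sum>r\<in>Q. \<Sum>q\<in>{q\<in>Q. r \<le> q}. m q r)"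
      by (intro sum.cong) auto
    also have "\<dots> = (\<Sum>q\<in>Q. \<Sum>r\<in>{r\<in>Q. r \<le> q}. m q r)" using Q by (intro sum.swap_restrict) auto
    also have "\<dots> = (\<Sum>q\<in>Q. \<Sum>r\<in>Q \<inter> {..q}. m r q)" by (intro sum.cong) (auto simp: sym)
    finally show ?thesis .
  qed
  have "(\<Sum>q\<in>Q. \<Sum>r\<in>Q. m q r) = (\<Sum>r\<in>Q. \<Sum>q\<in>Q. m q r)" by (rule sum.swap)
  also have "\<dots> \<le> (\<Sum>r\<in>Q. (\<Sum>q\<in>Q \<inter> {..r}. m q r) + (\<Sum>q\<in>Q \<inter> {r..}. m q r))"
    by (intro sum_mono split)
  also have "\<dots> = 2 * (\<Sum>r\<in>Q. \<Sum>q\<in>Q \<inter> {..r}. m q r)" by (simp add: sum.distrib swap)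
  also have "\<dots> \<le> 2 * (\<Sum>r\<in>Q. \<Sum>q\<in>Q \<inter> {..r}. 8 * (1 + C\<^sub>0) * (\<psi> q * \<psi> r) + 2 * (\<psi> r * (real (gcd q r) / real r)))"
    unfolding m_def using Q by (intro mult_left_mono sum_mono measure_arcs_Int_le) auto
  also have "\<dots> = 16 * (1 + C\<^sub>0) * (\<Sum>r\<in>Q. \<Sum>q\<in>Q \<inter> {..r}. \<psi> q * \<psi> r)
       + 4 * (\<Sum>r\<in>Q. \<Sum>q\<in>Q \<inter> {..r}. \<psi> r * (real (gcd q r) / real r))"
  proof -
    have linear: "(\<Sum>r\<in>Q. \<Sum>q\<in>Q \<inter> {..r}. a * f q r + c * h q r)
        = a * (\<Sum>r\<in>Q. \<Sum>q\<in>Q \<inter> {..r}. f q r) + c * (\<Sum>r\<in>Q. \<Sum>q\<in>Q \<inter> {..r}. h q r)"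
      for a c :: real and f h :: "nat \<Rightarrow> nat \<Rightarrow> real"
      by (simp only: sum.distrib sum_distrib_left)
    have "2 * (8 * (1 + C\<^sub>0) * X + 2 * Y) = 16 * (1 + C\<^sub>0) * X + 4 * Y" for X Y :: real
      by simp
    then show ?thesis
      unfolding linear[of "8 * (1 + C\<^sub>0)" "\<lambda>q r. \<psi> q * \<psi> r" 2 "\<lambda>q r. \<psi> r * (real (gcd q r) / real r)"] .
  qed
  also have "\<dots> \<le> 16 * (1 + C\<^sub>0) * (sum \<psi> Q)\<^sup>2 + 4 * (C * (sum \<psi> Q)\<^sup>2)"
  proof (intro add_mono mult_left_mono C)
    have "(\<Sum>r\<in>Q. \<Sum>q\<in>Q \<inter> {..r}. \<psi> q * \<psi> r) \<le> (\<Sum>r\<in>Q. \<Sum>q\<in>Q. \<psi> q * \<psi> r)"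
      using Q psi_pos by (intro sum_mono sum_mono2) (auto simp: less_imp_le)
    also have "\<dots> = (sum \<psi> Q)\<^sup>2" by (simp add: power2_eq_square sum_product mult.commute)
    finally show "(\<Sum>r\<in>Q. \<Sum>q\<in>Q \<inter> {..r}. \<psi> q * \<psi> r) \<le> (sum \<psi> Q)\<^sup>2" .
  qed (use C0_pos in auto)
  finally show ?thesis by (simp add: m_def algebra_simps)
qed

text \<open>Let \<open>B\<close> be the missed set and suppose it has measure \<open>b > 0\<close>. Choose a compact \<open>Kc \<subseteq> B\<close> with measure at least
  \<open>b/2\<close>, an open \<open>T \<supseteq> B\<close> with \<open>T - B\<close> tiny, and a grid so fine that the cells meeting \<open>Kc\<close> stay inside \<open>T\<close>;
  \<open>U\<close> is the union of these cells. The first moment on \<open>U\<close> is at least \<open>\<Psi> b / (2M)\<close>. Since the arcs avoid \<open>B\<close>, it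
  lives on \<open>D = U - B\<close>, where the second moment bound makes it smaller.\<close>
lemma negligible_missed_points:
  assumes C: "C > 0"
    and Q: "\<And>K. \<exists>Q. finite Q \<and> Q \<subseteq> {q. K < q \<and> P q} \<and> 0 < sum \<psi> Q \<and>
           (\<Sum>r\<in>Q. \<Sum>q\<in>Q \<inter> {..r}. \<psi> r * (real (gcd q r) / real r)) \<le> C * (sum \<psi> Q)\<^sup>2"
  shows "negligible ({0..<1} - (\<Union>q\<in>{q. K < q \<and> P q}. arcs q))"
proof (rule ccontr)
  define B where "B = {0..<1::real} - (\<Union>q\<in>{q. K < q \<and> P q}. arcs q)"
  assume "\<not> negligible ({0..<1} - (\<Union>q\<in>{q. K < q \<and> P q}. arcs q))"
  then have nn: "\<not> negligible B" by (simp add: B_def)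
  have Bl: "B \<in> lmeasurable"
  proof -
    have "open (\<Union>q\<in>{q. K < q \<and> P q}. arcs q)" by (intro open_UN ballI open_arcs)
    then show ?thesis unfolding B_def by (intro fmeasurable_Diff) (auto intro: fmeasurableI)
  qed
  define b where "b = measure lebesgue B"
  have b: "b > 0" using nn Bl unfolding b_def
    by (metis measure_nonneg negligible_iff_measure order_le_less)
  define M where "M = real spacing"
  have M: "M > 0" using spacing by (simp add: M_def)
  define C2 where "C2 = 16 * (1 + C\<^sub>0) + 4 * C"
  have C2: "C2 > 0" using C C0_pos by (simp add: C2_def)
  \<comment> \<open>\<open>s\<close> and then \<open>\<eta>\<close> are chosen to make the two terms of the second moment inequality, with
      \<open>lam = s \<Psi>\<close>, at most \<open>\<Psi> b / (2M)\<close> and \<open>\<Psi> b / (4M)\<close>; their mean is less than \<open>\<Psi> b / (2M)\<close>\<close>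
  define s where "s = 2 * M * C2 / b"
  have s: "s > 0" using M C2 b by (simp add: s_def)
  define \<eta> where "\<eta> = b / (4 * M * s)"
  have \<eta>: "\<eta> > 0" using M b s by (simp add: \<eta>_def)
  have less: "measure lebesgue S < x" if "S \<in> lmeasurable" "emeasure lebesgue S < ennreal x" for S :: "real set" and x
  proof -
    have "ennreal (measure lebesgue S) < ennreal x"
      using that(2) by (simp only: emeasure_eq_measure2[OF that(1)])
    then show ?thesis by (simp add: ennreal_less_iff)
  qed
  obtain T where T: "open T" "B \<subseteq> T" "T - B \<in> lmeasurable" "measure lebesgue (T - B) < \<eta>"
    using sets_lebesgue_outer_open[OF fmeasurableD[OF Bl] \<eta>] less by metis
  obtain Kc where Kc': "closed Kc" "Kc \<subseteq> B" "measure lebesgue (B - Kc) < b / 2"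
    using sets_lebesgue_inner_closed[OF fmeasurableD[OF Bl], of "b/2"] less b by (metis half_gt_zero)
  have "bounded Kc" using Kc'(2) by (intro bounded_subset[OF bounded_cbox[of 0 "1::real"]]) (auto simp: B_def)
  with Kc' have Kc: "compact Kc" "Kc \<subseteq> B" "measure lebesgue (B - Kc) < b / 2"
    by (auto simp: compact_eq_bounded_closed)
  obtain e where e: "e > 0" "(\<Union>x\<in>Kc. ball x e) \<subseteq> T"
    using compact_subset_open_imp_ball_epsilon_subset[OF Kc(1) T(1)] Kc T by blast
  obtain N where N: "N \<ge> 1" "1 / real N < e"
    by (metis e(1) less_eq_Suc_le nat_approx_posE zero_less_Suc One_nat_def)
  define cell where "cell i = {real i / real N..<real (i + 1) / real N}" for i
  define I where "I = {i\<in>{..<N}. cell i \<inter> Kc \<noteq> {}}"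
  define U where "U = (\<Union>i\<in>I. cell i)"
  have finI: "finite I" by (simp add: I_def)
  have KU: "Kc \<subseteq> U"
  proof
    fix x assume x: "x \<in> Kc"
    then have x01: "0 \<le> x" "x < 1" using Kc by (auto simp: B_def)
    define i where "i = nat \<lfloor>x * real N\<rfloor>"
    have "real i \<le> x * real N" "x * real N < real i + 1" unfolding i_def using x01 by auto
    then have "x \<in> cell i" using N by (simp add: cell_def field_simps)
    moreover have "x * real N < 1 * real N" using x01 N by (intro mult_strict_right_mono) auto
    then have "i < N" using \<open>real i \<le> x * real N\<close> by linarith
    ultimately show "x \<in> U" using x by (auto simp: U_def I_def)
  qed
  have UT: "U \<subseteq> T"
  proof
    fix x assume "x \<in> U"
    then obtain i x' where i: "x \<in> cell i" "x' \<in> cell i" "x' \<in> Kc" by (auto simp: U_def I_def)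
    then have "\<bar>x' - x\<bar> < 1 / real N" using N by (auto simp: cell_def add_divide_distrib abs_less_iff)
    then have "x \<in> ball x' e" using N by (simp add: dist_real_def)
    then show "x \<in> T" using e i by blast
  qed
  have cellm: "cell i \<in> lmeasurable" "measure lebesgue (cell i) = 1 / real N" for i
  proof -
    have "real i / real N \<le> real (i + 1) / real N" by (intro divide_right_mono) auto
    then show "measure lebesgue (cell i) = 1 / real N" by (simp add: cell_def diff_divide_distrib [symmetric])
    have "bounded (cell i)"
      by (rule bounded_subset[OF bounded_cbox[of "real i / real N" "real (i + 1) / real N"]]) (auto simp: cell_def)
    then show "cell i \<in> lmeasurable" by (rule bounded_set_imp_lmeasurable) (simp add: cell_def)
  qed
  have disj: "disjoint_family_on cell I"
    unfolding disjoint_family_on_def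
  proof (intro ballI impI)
    fix i j :: nat assume "i \<noteq> j"
    show "cell i \<inter> cell j = {}"
    proof (rule ccontr)
      assume "cell i \<inter> cell j \<noteq> {}"
      then obtain x where "x \<in> cell i" "x \<in> cell j" by blast
      then have "real i \<le> x * real N" "x * real N < real i + 1" "real j \<le> x * real N" "x * real N < real j + 1"
        using N by (auto simp: cell_def field_simps)
      then have "i = j" by linarith
      with \<open>i \<noteq> j\<close> show False by contradiction
    qed
  qed
  have Ul: "U \<in> lmeasurable" unfolding U_def using finI cellm by (intro fmeasurable.finite_UN) auto
  have mU: "measure lebesgue U = real (card I) / real N"
  proof -
    have "measure lebesgue U = (\<Sum>i\<in>I. measure lebesgue (cell i))"
      unfolding U_def using finI disj cellm by (intro measure_UN_disjoint_lmeasurable) auto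
    then show ?thesis by (simp add: cellm)
  qed
  have Ub: "b / 2 \<le> measure lebesgue U"
  proof -
    have Kl: "Kc \<in> lmeasurable" using Kc by (simp add: lmeasurable_compact)
    have "measure lebesgue (B - Kc) = b - measure lebesgue Kc"
      unfolding b_def using Bl Kl Kc(2) by (intro measure_Diff) (auto simp: fmeasurable_def)
    with Kc have "b / 2 \<le> measure lebesgue Kc" by simp
    also have "\<dots> \<le> measure lebesgue U"
      using KU Kl Ul by (intro measure_mono_fmeasurable) auto
    finally show ?thesis .
  qed
  define D where "D = U - B"
  have D: "D \<in> lmeasurable" "measure lebesgue D \<le> \<eta>"
  proof -
    show 1: "D \<in> lmeasurable" unfolding D_def using Ul Bl by (intro fmeasurable_Diff) auto
    have "measure lebesgue D \<le> measure lebesgue (T - B)"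
      using UT T 1 by (intro measure_mono_fmeasurable) (auto simp: D_def)
    with T show "measure lebesgue D \<le> \<eta>" by simp
  qed
  obtain q\<^sub>0 where q0: "\<And>q i. q \<ge> q\<^sub>0 \<Longrightarrow> i < N \<Longrightarrow> \<psi> q / (real N * M) \<le> measure lebesgue (arcs q \<inter> cell i)"
    using measure_arcs_cell_ge[OF N(1)] unfolding M_def cell_def by blast
  obtain Q where Q: "finite Q" "Q \<subseteq> {q. max K q\<^sub>0 < q \<and> P q}" "0 < sum \<psi> Q"
     "(\<Sum>r\<in>Q. \<Sum>q\<in>Q \<inter> {..r}. \<psi> r * (real (gcd q r) / real r)) \<le> C * (sum \<psi> Q)\<^sup>2"
    using assms(2)[of "max K q\<^sub>0"] by blast
  have Q1: "q \<ge> 1" "q \<ge> q\<^sub>0" "K < q" "P q" if "q \<in> Q" for q using Q(2) that by auto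
  define \<Psi> where "\<Psi> = sum \<psi> Q"
  have \<Psi>: "\<Psi> > 0" using Q by (simp add: \<Psi>_def)
  have first: "\<psi> q / M * (b / 2) \<le> measure lebesgue (arcs q \<inter> D)" if q: "q \<in> Q" for q
  proof -
    have pq: "\<psi> q > 0" using psi_pos Q1[OF q] by simp
    have "\<psi> q / M * (b / 2) \<le> \<psi> q / M * measure lebesgue U" using Ub pq M by (intro mult_left_mono) auto
    also have "\<dots> = (\<Sum>i\<in>I. \<psi> q / (real N * M))" by (simp add: mU mult_ac)
    also have "\<dots> \<le> (\<Sum>i\<in>I. measure lebesgue (arcs q \<inter> cell i))"
      using Q1[OF q] by (intro sum_mono q0) (auto simp: I_def)
    also have "\<dots> = measure lebesgue (\<Union>i\<in>I. arcs q \<inter> cell i)"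
    proof (intro measure_UN_disjoint_lmeasurable [symmetric] finI)
      show "disjoint_family_on (\<lambda>i. arcs q \<inter> cell i) I" using disj by (auto simp: disjoint_family_on_def)
      show "arcs q \<inter> cell i \<in> lmeasurable" for i
        using arcs_lmeasurable[OF Q1(1)[OF q]] cellm by (intro fmeasurable.Int) auto
    qed
    also have "(\<Union>i\<in>I. arcs q \<inter> cell i) = arcs q \<inter> D"
      using Q1[OF q] by (auto simp: U_def D_def B_def)
    finally show ?thesis .
  qed
  have "\<Psi> / M * (b / 2) = (\<Sum>q\<in>Q. \<psi> q / M * (b / 2))"
    by (simp only: \<Psi>_def sum_divide_distrib sum_distrib_right)
  also have "\<dots> \<le> (\<Sum>q\<in>Q. measure lebesgue (arcs q \<inter> D))" by (intro sum_mono first)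
  also have "\<dots> \<le> ((\<Sum>q\<in>Q. \<Sum>r\<in>Q. measure lebesgue (arcs q \<inter> arcs r)) / (s * \<Psi>) + (s * \<Psi>) * measure lebesgue D) / 2"
    using Q(1) Q1 D s \<Psi> by (intro sum_measure_Int_le_second_moment arcs_lmeasurable) auto
  also have "\<dots> \<le> (C2 * \<Psi>\<^sup>2 / (s * \<Psi>) + (s * \<Psi>) * \<eta>) / 2"
    unfolding C2_def \<Psi>_def using Q1 Q s D
    by (intro divide_right_mono add_mono mult_left_mono sum_measure_arcs_Int_le) auto
  also have "\<dots> = \<Psi> * (b / (2 * M) + b / (4 * M)) / 2"
  proof -
    have "C2 * \<Psi>\<^sup>2 / (s * \<Psi>) = \<Psi> * (b / (2 * M))"
      using \<Psi> C2 M b by (simp add: s_def power2_eq_square)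
    moreover have "(s * \<Psi>) * \<eta> = \<Psi> * (b / (4 * M))" using s by (simp add: \<eta>_def)
    ultimately show ?thesis by (simp add: algebra_simps)
  qed
  also have "\<dots> < \<Psi> / M * (b / 2)" using \<Psi> M b by (simp add: field_simps)
  finally show False by simp
qed

lemma mem_W_setI:
  assumes "x \<in> torus" "\<And>K. \<exists>q>K. [q = z] (mod y) \<and> x \<in> arcs q"
  shows "x \<in> W_set y z \<psi> (\<lambda>a q. \<gamma> q + \<epsilon> a q)"
proof -
  let ?S = "{q. 1 \<le> q \<and> [q = z] (mod y) \<and>
        (\<exists>a::int. dist_nearest_int (x - (of_int a + (\<gamma> q + \<epsilon> a q)) / real q) < \<psi> q / real q)}"
  have "infinite ?S"
    unfolding infinite_nat_iff_unbounded
  proof (intro allI)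
    fix K
    obtain q where q: "q > K" "[q = z] (mod y)" "x \<in> arcs q" using assms(2) by blast
    then obtain a where a: "dist (centre q a) x < \<psi> q / real q" by (auto simp: arcs_def)
    have "dist_nearest_int (x - centre q a) \<le> dist (x - centre q a) 0"
      unfolding dist_nearest_int_def by (rule infdist_le) simp
    with a have "dist_nearest_int (x - centre q a) < \<psi> q / real q" by (simp add: dist_real_def)
    then show "\<exists>n>K. n \<in> ?S" using q unfolding centre_def by auto
  qed
  then show ?thesis using assms(1) by (simp add: W_set_def)
qed

end

text \<open>Completeness of Lebesgue measure supplies the measurability of \<open>W\<close>.\<close>
lemma measure_torus_eq_1:
  assumes "W \<subseteq> torus" "negligible (torus - W)"
  shows "measure torus_measure W = 1"
proof -
  have null: "torus - W \<in> null_sets lebesgue" using assms(2) by (simp add: negligible_iff_null_sets)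
  have t: "torus \<in> sets lebesgue" by (simp add: torus_def)
  have "measure torus_measure W = measure lebesgue W"
    unfolding torus_measure_def using t assms(1) by (intro measure_restrict_space) auto
  also have "\<dots> = measure lebesgue (torus - (torus - W))"
    using assms(1) by (intro arg_cong[where f="measure lebesgue"]) auto
  also have "\<dots> = measure lebesgue torus"
    using t null by (rule measure_Diff_null_set)
  also have "\<dots> = 1" by (simp add: torus_def)
  finally show ?thesis .
qed

theorem theorem4p2:
  fixes \<psi> :: "nat \<Rightarrow> real" and \<gamma> :: "nat \<Rightarrow> real"
    and \<epsilon> :: "int \<Rightarrow> nat \<Rightarrow> real" and C\<^sub>0 :: real
  assumes "\<forall>q\<ge>1. 0 < \<psi> q"
    and "antimono_on {1..} \<psi>"
    and "\<exists>\<delta>>0. \<exists>k\<ge>2. weighted_series_diverges \<psi> k \<delta>"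
    and "0 < C\<^sub>0"
    and "\<forall>q\<ge>1. \<forall>a. \<epsilon> (a + int q) q = \<epsilon> a q"
    and "\<forall>q\<ge>1. \<forall>a. \<bar>\<epsilon> a q\<bar> \<le> C\<^sub>0 * \<psi> q"
  shows "\<forall>y\<ge>1. \<forall>z<y. measure torus_measure (W_set y z \<psi> (\<lambda>a q. \<gamma> q + \<epsilon> a q)) = 1"
proof (intro allI impI)
  fix y z :: nat assume y: "1 \<le> y" and "z < y"
  have pos: "0 < \<psi> q" if "q \<ge> 1" for q using assms(1) that by simp
  have mono: "\<psi> r \<le> \<psi> q" if "1 \<le> q" "q \<le> r" for q r
    using monotone_onD[OF assms(2), of q r] that by simp
  interpret moving_targets \<psi> \<gamma> \<epsilon> C\<^sub>0
    by unfold_locales (use pos mono assms(4,6) in auto)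
  obtain \<delta> k where \<delta>: "\<delta> > 0" "k \<ge> 2" "weighted_series_diverges \<psi> k \<delta>" using assms(3) by blast
  have unb: "\<exists>n\<ge>2. M * sqrt (ln (real n)) < (\<Sum>q=1..n. \<psi> q)" for M
    using \<delta>(3,1,2) pos by (rule weighted_series_diverges_imp_unbounded)
  obtain C where C: "C > 0" and Q: "\<And>K. \<exists>Q. finite Q \<and> Q \<subseteq> {q. K < q \<and> [q = z] (mod y)} \<and> 0 < sum \<psi> Q \<and>
           (\<Sum>r\<in>Q. \<Sum>q\<in>Q \<inter> {..r}. \<psi> r * (real (gcd q r) / real r)) \<le> C * (sum \<psi> Q)\<^sup>2"
    using exists_quasi_independent_indices[of y \<psi> z, OF y pos mono unb] by auto
  let ?W = "W_set y z \<psi> (\<lambda>a q. \<gamma> q + \<epsilon> a q)"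
  let ?B = "\<lambda>K. {0..<1} - (\<Union>q\<in>{q. K < q \<and> [q = z] (mod y)}. arcs q)"
  have "negligible (\<Union>K. ?B K)"
    using negligible_missed_points[OF C Q] by (intro negligible_countable_Union) auto
  moreover have "torus - ?W \<subseteq> (\<Union>K. ?B K)"
    using mem_W_setI[of _ z y] by (fastforce simp: torus_def)
  ultimately have "negligible (torus - ?W)" by (rule negligible_subset)
  then show "measure torus_measure ?W = 1"
    by (intro measure_torus_eq_1) (auto simp: W_set_def)
qed

end
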